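(* Let $\Omega_a,\Omega_b\subset\mathbb{R}^d\times\mathbb{R}^d$ be open, bounded, non-empty domains and let $\Omega=\Omega_a\cup\Omega_b$. Consider a sequence of observations $\hat\Omega_0=\{\hat x^{(j)}=(x_0^{(j)},x_1^{(j)},x_2^{(j)})\}_{j=1}^\infty$, with $(x_0^{(j)},x_1^{(j)})\in\Omega_a$ and $(x_1^{(j)},x_2^{(j)})\in\Omega_b$, of a discrete dynamical system with globally Lipschitz continuous discrete flow map $\overline{g_{\mathrm{ref}}}:\Omega_a\to\Omega_b$, $\overline{g_{\mathrm{ref}}}(x_0,x_1)=(x_1,g_{\mathrm{ref}}(x_0,x_1))$, related to a discrete Lagrangian $L_d^{\mathrm{ref}}\in\mathcal{C}^1(\overline\Omega)$, i.e. - $\overline{g_{\mathrm{ref}}}(x_0^{(j)},x_1^{(j)})=(x_1^{(j)},x_2^{(j)})$ for all $j\in\mathbb{N}$; - for all $(x_0,x_1)\in\Omega_a$, $\mathrm{DEL}(L_d^{\mathrm{ref}})(x_0,\overline{g_{\mathrm{ref}}}(x_0,x_1))=0$, and $x_2=g_{\mathrm{ref}}(x_0,x_1)$ is the solution of $\mathrm{DEL}(L_d^{\mathrm{ref}})(x_0,x_1,x_2)=0$ with $(x_1,x_2)\in\Omega_b$; - the matrix $\nabla_{1,2}L_d^{\mathrm{ref}}(x_1,x_2)\in\mathbb{R}^{d\times d}$ is invertible for all $(x_1,x_2)\in\overline{\Omega}_b$. Assume that $\{(x_0^{(j)},x_1^{(j)})\}_{j=1}^\infty$ is dense in $\Omega_a$.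 Let $K$ be a twice continuously differentiable kernel on $\Omega$, $\overline x_b\in\Omega$, $c_b\in\mathbb{R}$, $p_b\in\mathbb{R}^d$, and assume that $L_d^{\mathrm{ref}}$ is contained in the reproducing kernel Hilbert space $(U,\|\cdot\|_U)$ of $K$ and fulfils the normalisation condition $$\Phi_N(L_d^{\mathrm{ref}})=(p_b,c_b),\qquad\text{where }\Phi_N(L_d)=\left(-\nabla_1L_d(\overline x_b),\,L_d(\overline x_b)\right),$$ and that $U$ embeds continuously into $\mathcal{C}^1(\overline\Omega)$. Let $\xi\sim\mathcal{N}(0,\mathcal{K})$ be the canonical (centred) Gaussian field over $U$. Then the sequence of conditional means $L_{d,(j)}$ of $\xi$ conditioned on the first $j$ observations and the normalisation conditions, i.e. on $$\mathrm{DEL}(\xi)(\hat x^{(i)})=0\ (\forall i\le j),\qquad \Phi_N(\xi)=(p_b,c_b),$$ converges in $\|\cdot\|_U$ and in $\|\cdot\|_{\mathcal{C}^1(\overline\Omega)}$ to a discrete Lagrangian $L_{d,(\infty)}\in U$ such that: (1) $\Phi_N(L_{d,(\infty)})=(p_b,c_b)$; (2) $L_{d,(\infty)}$ is consistent with the dynamics, i.e. $\mathrm{DEL}(L_{d,(\infty)})(\hat x)=0$ for all $\hat x=(x_0,x_1,x_2)$ with $(x_0,x_1)\in\Omega_a$, $(x_1,x_2)\in\Omega_b$ and $\mathrm{DEL}(L_d^{\mathrm{ref}})(\hat x)=0$; (3) $L_{d,(\infty)}$ is the unique minimiser of $\|\cdot\|_U$ among all discrete Lagrangians in $U$ with properties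 (1) and (2).
   Context: A discrete Lagrangian is a real-valued function $L_d(x_0,x_1)$ on (a subset of) $\mathbb{R}^d\times\mathbb{R}^d$. $\nabla_1L_d$, $\nabla_2L_d$ denote the gradients with respect to the first and second ($\mathbb{R}^d$-valued) argument, and $\nabla_{1,2}L_d$ the $d\times d$ matrix of mixed second derivatives with respect to the first and second argument (assumed to exist where it is used). The discrete Euler--Lagrange operator is $\mathrm{DEL}(L_d)(x_0,x_1,x_2)=\nabla_2L_d(x_0,x_1)+\nabla_1L_d(x_1,x_2)\in\mathbb{R}^d$; $\mathrm{DEL}(L_d)(x_0,(x_1,x_2))$ means $\mathrm{DEL}(L_d)(x_0,x_1,x_2)$. $\mathcal{C}^m(\overline{\Omega})$ is the Banach space of $m$-times continuously differentiable real functions on $\Omega$ all of whose partial derivatives of order $\le m$ extend continuously to the closure $\overline\Omega$, with norm the maximum over orders $\le m$ of the sup norms of the derivatives. A kernel $K:\Omega\times\Omega\to\mathbb{R}$ is a symmetric function such that for every finite set of distinct points the matrix $(K(\overline x^{(i)},\overline x^{(j)}))_{i,j}$ is positive definite. $U$ is its reproducing kernel Hilbert space, $U^\ast$ the topological dual, and $\mathcal{K}:U^\ast\to U$ is $\mathcal{K}(\phi)(x)=\phi(K(x,\cdot))$. The canonical Gaussian field $\xi\sim\mathcal{N}(0,\mathcal{K})$ on $U$ is a linear map $\phi\mapsto\phi(\xi)$ from $U^\ast$ to a linear space of centred Gaussian random variables (contained in $L^2$ of a probability space) such that the variance of $\phi(\xi)$ is $\phi(\mathcal{K}\phi)$; consequently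 $(\phi_1(\xi),\dots,\phi_m(\xi))$ is multivariate normal with covariance matrix $(\phi_i(\mathcal{K}\phi_j))_{ij}$. For $\Phi=(\phi_1,\dots,\phi_m)\in(U^\ast)^m$ and $y\in\mathbb{R}^m$ the conditional mean of $\xi$ given $\Phi(\xi)=y$ is the element $L\in U$ such that for all $\phi\in U^\ast$ the conditional distribution of $\phi(\xi)$ given $\Phi(\xi)=y$ has mean $\phi(L)$; explicitly $L=\sum_{i,j=1}^m y_i(\Theta^\dagger)_{ij}\,\mathcal{K}\phi_j$ with $\Theta_{ij}=\phi_i(\mathcal{K}\phi_j)$ and $\Theta^\dagger$ the Moore--Penrose pseudo-inverse. Here $\Phi$ consists of all scalar components of the bounded functionals $L_d\mapsto\mathrm{DEL}(L_d)(\hat x^{(i)})$, $i\le j$, and of $\Phi_N$, and $y=(0,\dots,0,p_b,c_b)$. *)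

theory Defs
  imports "HOL-Probability.Probability"
begin

definition pd :: "'a \<Rightarrow> ('a::real_normed_vector \<Rightarrow> real) \<Rightarrow> 'a \<Rightarrow> real" where
  "pd b f x = deriv (\<lambda>t. f (x + t *\<^sub>R b)) 0"

primrec pds :: "'a list \<Rightarrow> ('a::real_normed_vector \<Rightarrow> real) \<Rightarrow> 'a \<Rightarrow> real" where
  "pds [] f = f"
| "pds (b # bs) f = pd b (pds bs f)"

definition multi :: "nat \<Rightarrow> 'a::euclidean_space list set" where
  "multi m = {bs. set bs \<subseteq> Basis \<and> length bs \<le> m}"

text \<open>Functions on an open set \<open>\<Omega>\<close> are total functions of which only the values on \<open>\<Omega>\<close>
  matter.\<close>

definition C_on :: "nat \<Rightarrow> 'a::euclidean_space set \<Rightarrow> ('a \<Rightarrow> real) set" where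
  "C_on m \<Omega> = {f. (\<forall>bs\<in>multi m. continuous_on \<Omega> (pds bs f)) \<and>
     (\<forall>bs\<in>multi m. length bs < m \<longrightarrow>
        (\<forall>b\<in>Basis. \<forall>x\<in>\<Omega>. (\<lambda>t. pds bs f (x + t *\<^sub>R b)) differentiable (at 0)))}"

definition C_closure :: "nat \<Rightarrow> 'a::euclidean_space set \<Rightarrow> ('a \<Rightarrow> real) set" where
  "C_closure m \<Omega> = {f \<in> C_on m \<Omega>.
     \<forall>bs\<in>multi m. \<exists>g. continuous_on (closure \<Omega>) g \<and> (\<forall>x\<in>\<Omega>. g x = pds bs f x)}"

definition C_norm :: "nat \<Rightarrow> 'a::euclidean_space set \<Rightarrow> ('a \<Rightarrow> real) \<Rightarrow> real" where
  "C_norm m \<Omega> f = (MAX bs\<in>multi m. SUP x\<in>\<Omega>. \<bar>pds bs f x\<bar>)"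

definition grad1 :: "((real^'d) \<times> (real^'d) \<Rightarrow> real) \<Rightarrow> (real^'d) \<times> (real^'d) \<Rightarrow> real^'d" where
  "grad1 L p = (\<chi> i. pd (axis i 1, 0) L p)"

definition grad2 :: "((real^'d) \<times> (real^'d) \<Rightarrow> real) \<Rightarrow> (real^'d) \<times> (real^'d) \<Rightarrow> real^'d" where
  "grad2 L p = (\<chi> i. pd (0, axis i 1) L p)"

definition DEL :: "((real^'d) \<times> (real^'d) \<Rightarrow> real) \<Rightarrow> real^'d \<Rightarrow> real^'d \<Rightarrow> real^'d \<Rightarrow> real^'d" where
  "DEL L x0 x1 x2 = grad2 L (x0, x1) + grad1 L (x1, x2)"

definition normalisation ::
    "(real^'d) \<times> (real^'d) \<Rightarrow> ((real^'d) \<times> (real^'d) \<Rightarrow> real) \<Rightarrow> (real^'d) \<times> real" where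
  "normalisation xb L = (- grad1 L xb, L xb)"

definition has_mixed ::
    "((real^'d) \<times> (real^'d) \<Rightarrow> real) \<Rightarrow> (real^'d) \<times> (real^'d) \<Rightarrow> real^'d^'d \<Rightarrow> bool" where
  "has_mixed L p A \<longleftrightarrow> (\<forall>i j.
     ((\<lambda>t. grad1 L (p + t *\<^sub>R (0, axis j 1)) $ i) has_real_derivative A $ i $ j) (at 0))"

text \<open>\<open>has_mixed_closure \<Omega> S L p A\<close>: the mixed derivative matrix of \<open>L\<close> (a function on \<open>\<Omega>\<close>) at a
  point \<open>p\<close> of the closure of \<open>S \<subseteq> \<Omega>\<close> is \<open>A\<close>. Outside \<open>\<Omega>\<close>, where \<open>L\<close> is not defined, it is the
  limit of the mixed derivatives on \<open>S\<close>.\<close>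

definition has_mixed_closure ::
    "((real^'d) \<times> (real^'d)) set \<Rightarrow> ((real^'d) \<times> (real^'d)) set \<Rightarrow>
     ((real^'d) \<times> (real^'d) \<Rightarrow> real) \<Rightarrow> (real^'d) \<times> (real^'d) \<Rightarrow> real^'d^'d \<Rightarrow> bool" where
  "has_mixed_closure \<Omega> S L p A \<longleftrightarrow>
     (if p \<in> \<Omega> then has_mixed L p A
      else \<exists>H. (\<forall>q\<in>S. has_mixed L q (H q)) \<and> (H \<longlongrightarrow> A) (at p within S))"

definition pd_kernel :: "'x set \<Rightarrow> ('x \<Rightarrow> 'x \<Rightarrow> real) \<Rightarrow> bool" where
  "pd_kernel \<Omega> K \<longleftrightarrow> (\<forall>x\<in>\<Omega>. \<forall>y\<in>\<Omega>. K x y = K y x) \<and>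
     (\<forall>S c. finite S \<and> S \<subseteq> \<Omega> \<and> (\<exists>x\<in>S. c x \<noteq> 0) \<longrightarrow> 0 < (\<Sum>x\<in>S. \<Sum>y\<in>S. c x * K x y * c y))"

text \<open>A Hilbert space of functions on \<open>\<Omega>\<close> is a Hilbert space \<open>'u\<close> together with the map \<open>fn\<close>
  taking \<open>u\<close> to the function it denotes; elements with equal functions on \<open>\<Omega>\<close> are equal. Linearity
  of \<open>u \<mapsto> fn u x\<close> for \<open>x \<in> \<Omega>\<close> is part of the reproducing property.\<close>

definition rkhs ::
    "'x set \<Rightarrow> ('x \<Rightarrow> 'x \<Rightarrow> real) \<Rightarrow> ('u::{real_inner,banach} \<Rightarrow> 'x \<Rightarrow> real) \<Rightarrow> bool" where
  "rkhs \<Omega> K fn \<longleftrightarrow>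
     (\<forall>u v. (\<forall>x\<in>\<Omega>. fn u x = fn v x) \<longrightarrow> u = v) \<and>
     (\<forall>x\<in>\<Omega>. \<exists>k. (\<forall>y\<in>\<Omega>. fn k y = K x y) \<and> (\<forall>u. fn u x = inner u k))"

definition elem :: "'x set \<Rightarrow> ('u \<Rightarrow> 'x \<Rightarrow> real) \<Rightarrow> ('x \<Rightarrow> real) \<Rightarrow> 'u" where
  "elem \<Omega> fn f = (THE u. \<forall>x\<in>\<Omega>. fn u x = f x)"

definition in_space :: "'x set \<Rightarrow> ('u \<Rightarrow> 'x \<Rightarrow> real) \<Rightarrow> ('x \<Rightarrow> real) \<Rightarrow> bool" where
  "in_space \<Omega> fn f \<longleftrightarrow> (\<exists>u. \<forall>x\<in>\<Omega>. fn u x = f x)"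

definition embeds_C ::
    "nat \<Rightarrow> 'a::euclidean_space set \<Rightarrow> ('u::real_normed_vector \<Rightarrow> 'a \<Rightarrow> real) \<Rightarrow> bool" where
  "embeds_C m \<Omega> fn \<longleftrightarrow> (\<forall>u. fn u \<in> C_closure m \<Omega>) \<and> (\<exists>c. \<forall>u. C_norm m \<Omega> (fn u) \<le> c * norm u)"

definition cov_op ::
    "'x set \<Rightarrow> ('x \<Rightarrow> 'x \<Rightarrow> real) \<Rightarrow> ('u::{real_inner,banach} \<Rightarrow> 'x \<Rightarrow> real) \<Rightarrow>
     ('u \<Rightarrow>\<^sub>L real) \<Rightarrow> 'u" where
  "cov_op \<Omega> K fn \<phi> = elem \<Omega> fn (\<lambda>x. blinfun_apply \<phi> (elem \<Omega> fn (K x)))"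

text \<open>The constant zero is included as a degenerate Gaussian.\<close>

definition centred_gaussian :: "'w measure \<Rightarrow> ('w \<Rightarrow> real) \<Rightarrow> bool" where
  "centred_gaussian M X \<longleftrightarrow> X \<in> borel_measurable M \<and>
     ((AE w in M. X w = 0) \<or> (\<exists>\<sigma>>0. distributed M lborel X (normal_density 0 \<sigma>)))"

definition gaussian_field ::
    "'w measure \<Rightarrow> (('u::real_normed_vector \<Rightarrow>\<^sub>L real) \<Rightarrow> 'u) \<Rightarrow>
     (('u \<Rightarrow>\<^sub>L real) \<Rightarrow> 'w \<Rightarrow> real) \<Rightarrow> bool" where
  "gaussian_field M \<K> \<xi> \<longleftrightarrow> prob_space M \<and>
     (\<forall>a b \<phi> \<psi>. AE w in M. \<xi> (a *\<^sub>R \<phi> + b *\<^sub>R \<psi>) w = a * \<xi> \<phi> w + b * \<xi> \<psi> w) \<and>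
     (\<forall>\<phi>. centred_gaussian M (\<xi> \<phi>) \<and> prob_space.variance M (\<xi> \<phi>) = blinfun_apply \<phi> (\<K> \<phi>))"

text \<open>\<open>\<kappa>\<close> is a regular conditional distribution of the real random variable \<open>X\<close> given the
  \<open>N\<close>-valued random variable \<open>Y\<close>.\<close>

definition cond_distribution ::
    "'w measure \<Rightarrow> ('w \<Rightarrow> real) \<Rightarrow> 'b measure \<Rightarrow> ('w \<Rightarrow> 'b) \<Rightarrow> ('b \<Rightarrow> real measure) \<Rightarrow> bool" where
  "cond_distribution M X N Y \<kappa> \<longleftrightarrow> \<kappa> \<in> N \<rightarrow>\<^sub>M prob_algebra borel \<and>
     (\<forall>A\<in>sets borel. \<forall>B\<in>sets N. measure M {w \<in> space M. X w \<in> A \<and> Y w \<in> B} =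
        (LINT y:B|distr M N Y. measure (\<kappa> y) A))"

text \<open>Vectors in \<open>\<real>\<^sup>m\<close> are extensional functions on a finite index set \<open>I\<close>. A regular conditional
  distribution is only determined up to null sets of values; its value at a single point \<open>y\<close> refers
  to the version that depends continuously (for weak convergence) on the value. At points of the
  support of the conditioning variable this determines it.\<close>

definition weakly_continuous :: "'i set \<Rightarrow> (('i \<Rightarrow> real) \<Rightarrow> real measure) \<Rightarrow> bool" where
  "weakly_continuous I \<kappa> \<longleftrightarrow> (\<forall>z y. (\<forall>n. z n \<in> extensional I) \<and> y \<in> extensional I \<and>
     (\<forall>i\<in>I. (\<lambda>n. z n i) \<longlonglongrightarrow> y i) \<longrightarrow> weak_conv_m (\<lambda>n. \<kappa> (z n)) (\<kappa> y))"

definition is_cond_mean ::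
    "'w measure \<Rightarrow> (('u::real_normed_vector \<Rightarrow>\<^sub>L real) \<Rightarrow> 'w \<Rightarrow> real) \<Rightarrow>
     'i set \<Rightarrow> ('i \<Rightarrow> 'u \<Rightarrow>\<^sub>L real) \<Rightarrow> ('i \<Rightarrow> real) \<Rightarrow> 'u \<Rightarrow> bool" where
  "is_cond_mean M \<xi> I \<Phi> y L \<longleftrightarrow> (\<forall>\<psi>. \<exists>\<kappa>.
     cond_distribution M (\<xi> \<psi>) (\<Pi>\<^sub>M i\<in>I. borel) (\<lambda>w. \<lambda>i\<in>I. \<xi> (\<Phi> i) w) \<kappa> \<and>
     weakly_continuous I \<kappa> \<and>
     integrable (\<kappa> (restrict y I)) (\<lambda>t. t) \<and>
     (LINT t|\<kappa> (restrict y I). t) = blinfun_apply \<psi> L)"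

text \<open>The scalar components of the observation functionals: \<open>Dyn i a\<close> is the component \<open>a\<close> of \<open>DEL\<close>
  at the observation \<open>i\<close>; \<open>Mom a\<close> and \<open>Val\<close> are those of the normalisation.\<close>

datatype 'd obs = Dyn nat 'd | Mom 'd | Val

fun obs_map ::
    "(nat \<Rightarrow> (real^'d) \<times> (real^'d) \<times> (real^'d)) \<Rightarrow> (real^'d) \<times> (real^'d) \<Rightarrow> 'd obs \<Rightarrow>
     ((real^'d) \<times> (real^'d) \<Rightarrow> real) \<Rightarrow> real" where
  "obs_map X xb (Dyn i a) L = (case X i of (x0, x1, x2) \<Rightarrow> DEL L x0 x1 x2 $ a)"
| "obs_map X xb (Mom a) L = fst (normalisation xb L) $ a"
| "obs_map X xb Val L = snd (normalisation xb L)"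

fun obs_val :: "real^'d \<Rightarrow> real \<Rightarrow> 'd obs \<Rightarrow> real" where
  "obs_val p c (Dyn i a) = 0"
| "obs_val p c (Mom a) = p $ a"
| "obs_val p c Val = c"

definition obs_upto :: "nat \<Rightarrow> 'd obs set" where
  "obs_upto j = {Dyn i a | i a. i < j} \<union> range Mom \<union> {Val}"

text \<open>\<open>lagrangian_mean M \<xi> fn X xb p c j L\<close>: \<open>L\<close> is the conditional mean of \<open>\<xi>\<close> given the first \<open>j\<close>
  observations \<open>X 0, \<dots>, X (j - 1)\<close> and the normalisation conditions.\<close>

definition lagrangian_mean ::
    "'w measure \<Rightarrow> (('u::real_normed_vector \<Rightarrow>\<^sub>L real) \<Rightarrow> 'w \<Rightarrow> real) \<Rightarrow>
     ('u \<Rightarrow> (real^'d) \<times> (real^'d) \<Rightarrow> real) \<Rightarrow>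
     (nat \<Rightarrow> (real^'d) \<times> (real^'d) \<times> (real^'d)) \<Rightarrow> (real^'d) \<times> (real^'d) \<Rightarrow> real^'d \<Rightarrow> real \<Rightarrow>
     nat \<Rightarrow> 'u \<Rightarrow> bool" where
  "lagrangian_mean M \<xi> fn X xb p c j L \<longleftrightarrow>
     is_cond_mean M \<xi> (obs_upto j) (\<lambda>s. Blinfun (\<lambda>u. obs_map X xb s (fn u))) (obs_val p c) L"

definition consistent ::
    "((real^'d) \<times> (real^'d)) set \<Rightarrow> ((real^'d) \<times> (real^'d)) set \<Rightarrow>
     ((real^'d) \<times> (real^'d) \<Rightarrow> real) \<Rightarrow> ((real^'d) \<times> (real^'d) \<Rightarrow> real) \<Rightarrow> bool" where
  "consistent \<Omega>a \<Omega>b Lref L \<longleftrightarrow> (\<forall>x0 x1 x2. (x0, x1) \<in> \<Omega>a \<and> (x1, x2) \<in> \<Omega>b \<and>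
     DEL Lref x0 x1 x2 = 0 \<longrightarrow> DEL L x0 x1 x2 = 0)"

end

theory Submission
  imports Defs
begin

text \<open>The conditional means are minimum norm interpolants, and minimum norm interpolants under a
  growing list of linear constraints converge.

  Since \<open>U\<close> embeds into \<open>C\<^sup>1\<close>, every scalar observation is a bounded linear functional, hence of the
  form \<open>u \<mapsto> r s \<bullet> u\<close> by the Riesz representation theorem. By the same theorem the Gaussian field
  becomes an isonormal process: \<open>G u = \<xi> (u \<bullet> _)\<close> is centred Gaussian with variance
  \<open>(norm u)\<^sup>2\<close>.

  Conditioning (\<open>is_cond_mean_iff_projection\<close>). Let \<open>V\<close> be the span of finitely many \<open>r s\<close>, and split
  \<open>v = (\<Sum>s. c s *\<^sub>R r s) + p\<close> with \<open>p\<close> orthogonal to \<open>V\<close>. Orthogonal elements of an isonormal process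
  are independent (\<open>joint_distr_orthogonal\<close>), so given that the observations have the values \<open>y s\<close>, the
  variable \<open>G v\<close> is distributed as \<open>(\<Sum>s. c s * y s) + G p\<close>. This version of the conditional
  distribution depends weakly continuously on \<open>y\<close>. If \<open>y\<close> consists of the observed values of some
  \<open>u \<in> U\<close>, then its mean is \<open>v \<bullet> P\<close>, where \<open>P\<close> is the projection of \<open>u\<close> to \<open>V\<close>. No other
  element is a conditional mean: such a \<open>y\<close> lies in the support of the observations
  (\<open>prob_jointly_near_pos\<close>), where weakly continuous versions agree
  (\<open>cond_distribution_unique_at_support\<close>).

  Convergence. Apply this to the element \<open>u0\<close> of \<open>U\<close> that represents the reference Lagrangian. The
  projections \<open>P j\<close> of \<open>u0\<close> to the increasing spans satisfy \<open>P j \<bullet> (P k - P j) = 0\<close> for \<open>j \<le> k\<close> and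
  have norm at most that of \<open>u0\<close>. By Pythagoras their norms increase, so they form a Cauchy sequence
  (\<open>convergent_of_increasing_projections\<close>). The limit satisfies all constraints and is orthogonal to
  its difference from any other element that does, so it is the unique one of minimal norm.

  Dynamics. An element of \<open>U\<close> satisfies all constraints if and only if it is normalised and
  consistent: the discrete Euler-Lagrange operator along the flow,
  \<open>p \<mapsto> grad2 L p + grad1 L (gbar p)\<close>, is continuous on \<open>\<Omega>a\<close> and vanishes at the dense
  observations, and by uniqueness of solutions every solution of the reference equation lies on the
  flow.\<close>

section \<open>Hilbert spaces\<close>

lemma Cauchy_if_norm_diff_square_le:
  fixes x :: "nat \<Rightarrow> 'u::real_normed_vector"
  assumes bound: "\<And>n k. n \<le> k \<Longrightarrow> (norm (x k - x n))\<^sup>2 \<le> e n" and e: "e \<longlonglongrightarrow> 0"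
  shows "Cauchy x"
proof (rule CauchyI')
  fix \<epsilon> :: real assume \<epsilon>: "0 < \<epsilon>"
  with e have "eventually (\<lambda>n. e n < \<epsilon>\<^sup>2) sequentially"
    by (intro order_tendstoD(2)[OF e]) auto
  then obtain N where N: "\<And>n. n \<ge> N \<Longrightarrow> e n < \<epsilon>\<^sup>2" by (auto simp: eventually_sequentially)
  have "dist (x m) (x n) < \<epsilon>" if "m \<ge> N" "n > m" for m n
  proof -
    have "(norm (x n - x m))\<^sup>2 < \<epsilon>\<^sup>2" using bound[of m n] N[of m] that by auto
    then show ?thesis using \<epsilon> by (simp add: power2_less_imp_less dist_norm norm_minus_commute)
  qed
  then show "\<exists>M. \<forall>m\<ge>M. \<forall>n>m. dist (x m) (x n) < \<epsilon>" by blast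
qed

text \<open>The representing element is the minimiser of \<open>J x = (norm x)\<^sup>2 - 2 * \<phi> x\<close>. A minimising sequence
  is Cauchy by the parallelogram law, and at a minimum the derivative of \<open>J\<close> in every direction \<open>v\<close>,
  which is \<open>2 * (r \<bullet> v - \<phi> v)\<close>, vanishes.\<close>

lemma Riesz_representation:
  fixes \<phi> :: "'u::{real_inner,banach} \<Rightarrow>\<^sub>L real"
  shows "\<exists>r. \<phi> = blinfun_inner_right r"
proof -
  define J where "J x = (norm x)\<^sup>2 - 2 * \<phi> x" for x
  have J_lower: "- (norm \<phi>)\<^sup>2 \<le> J x" for x
  proof -
    have "\<phi> x \<le> norm \<phi> * norm x" using norm_blinfun[of \<phi> x] by simp
    moreover have "0 \<le> (norm x - norm \<phi>)\<^sup>2" by simp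
    ultimately show ?thesis unfolding J_def by (simp add: power2_eq_square algebra_simps)
  qed
  define m where "m = (INF x. J x)"
  have bdd: "bdd_below (range J)" using J_lower by (auto intro: bdd_belowI[of _ "- (norm \<phi>)\<^sup>2"])
  have m_le: "m \<le> J x" for x unfolding m_def using bdd by (simp add: cINF_lower)
  have "\<exists>x. J x < m + 1 / real (Suc n)" for n
    using cInf_lessD[of "range J" "m + 1 / real (Suc n)"] unfolding m_def by auto
  then obtain x where x: "\<And>n. J (x n) < m + 1 / real (Suc n)" by metis
  have para: "(norm (y - z))\<^sup>2 \<le> 2 * (J y - m) + 2 * (J z - m)" for y z
  proof -
    have "J y + J z - 2 * J ((1/2) *\<^sub>R (y + z)) = (norm (y - z))\<^sup>2 / 2"
      unfolding J_def blinfun.scaleR_right blinfun.add_right power2_norm_eq_inner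
      by (simp add: inner_add inner_diff inner_commute[of z y] algebra_simps)
    then show ?thesis using m_le[of "(1/2) *\<^sub>R (y + z)"] by simp
  qed
  have "Cauchy x"
  proof (rule Cauchy_if_norm_diff_square_le)
    fix n k :: nat assume "n \<le> k"
    define a where "a = 1 / real (Suc n)"
    have "1 / real (Suc k) \<le> a" using \<open>n \<le> k\<close> by (simp add: a_def frac_le)
    then have J: "J (x k) - m \<le> a" "J (x n) - m \<le> a"
      using less_imp_le[OF x[of n]] less_imp_le[OF x[of k]] by (auto simp: a_def)
    have "(norm (x k - x n))\<^sup>2 \<le> 2 * a + 2 * a"
      by (rule order_trans[OF para[of "x k" "x n"]]) (use J in \<open>intro add_mono mult_left_mono; simp\<close>)
    then show "(norm (x k - x n))\<^sup>2 \<le> 4 * (1 / real (Suc n))" by (simp add: a_def)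
  next
    show "(\<lambda>n. 4 * (1 / real (Suc n))) \<longlonglongrightarrow> 0"
      using tendsto_mult_right_zero[OF LIMSEQ_inverse_real_of_nat, of 4]
      by (simp add: inverse_eq_divide)
  qed
  then obtain r where r: "x \<longlonglongrightarrow> r" using convergent_eq_Cauchy by blast
  have "(\<lambda>n. J (x n)) \<longlonglongrightarrow> J r" unfolding J_def by (intro tendsto_intros r)
  moreover have "(\<lambda>n. m + 1 / real (Suc n)) \<longlonglongrightarrow> m"
    using tendsto_add[OF tendsto_const LIMSEQ_inverse_real_of_nat, of m] by (simp add: inverse_eq_divide)
  ultimately have "J r \<le> m" by (rule LIMSEQ_le) (use x in \<open>auto intro!: less_imp_le\<close>)
  then have min: "J r \<le> J v" for v using m_le[of v] by linarith
  have "\<phi> v = r \<bullet> v" for v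
  proof (cases "v = 0")
    case False
    \<comment> \<open>The step along \<open>v\<close> that minimises the quadratic \<open>t \<mapsto> J (r + t *\<^sub>R v)\<close>.\<close>
    define t where "t = (\<phi> v - r \<bullet> v) / (v \<bullet> v)"
    have "J (r + t *\<^sub>R v) = J r + 2 * t * (r \<bullet> v - \<phi> v) + t\<^sup>2 * (v \<bullet> v)"
      unfolding J_def blinfun.scaleR_right blinfun.add_right power2_norm_eq_inner
      by (simp add: inner_add inner_commute[of v r] power2_eq_square algebra_simps)
    also have "\<dots> = J r - (\<phi> v - r \<bullet> v)\<^sup>2 / (v \<bullet> v)"
      using False unfolding t_def by (simp add: field_simps power2_eq_square)
    finally have "(\<phi> v - r \<bullet> v)\<^sup>2 / (v \<bullet> v) \<le> 0" using min[of "r + t *\<^sub>R v"] by linarith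
    moreover have "0 < v \<bullet> v" using False by simp
    ultimately have "(\<phi> v - r \<bullet> v)\<^sup>2 \<le> 0" by (simp add: pos_divide_le_eq)
    then show ?thesis by simp
  qed simp
  then show ?thesis by (intro exI[of _ r] blinfun_eqI) simp
qed

text \<open>Orthogonal projection to the span of a finite family, given by coefficients with respect to the
  family itself. The family may be linearly dependent, as observations can repeat; this is why the
  proof is one step of Gram-Schmidt per member instead of an inversion of the Gram matrix.\<close>

lemma orthogonal_residual_exists:
  fixes r :: "'i \<Rightarrow> 'u::real_inner"
  assumes "finite I"
  shows "\<exists>c. \<forall>i\<in>I. (v - (\<Sum>j\<in>I. c j *\<^sub>R r j)) \<bullet> r i = 0"
  using assms
proof (induction I arbitrary: v rule: finite_induct)
  case (insert k I)
  obtain c where c: "\<And>i. i \<in> I \<Longrightarrow> (v - (\<Sum>j\<in>I. c j *\<^sub>R r j)) \<bullet> r i = 0"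
    using insert.IH[of v] by auto
  obtain d where d: "\<And>i. i \<in> I \<Longrightarrow> (r k - (\<Sum>j\<in>I. d j *\<^sub>R r j)) \<bullet> r i = 0"
    using insert.IH[of "r k"] by auto
  define p where "p = r k - (\<Sum>j\<in>I. d j *\<^sub>R r j)"
  define q where "q = v - (\<Sum>j\<in>I. c j *\<^sub>R r j)"
  \<comment> \<open>If \<open>r k\<close> depends linearly on the others, then \<open>p = 0\<close> and \<open>t = 0\<close>, as \<open>x / 0 = 0\<close>.\<close>
  define t where "t = q \<bullet> p / (p \<bullet> p)"
  define c' where "c' j = (if j = k then t else c j - t * d j)" for j
  have "(\<Sum>j\<in>I. c' j *\<^sub>R r j) = (\<Sum>j\<in>I. c j *\<^sub>R r j) - t *\<^sub>R (\<Sum>j\<in>I. d j *\<^sub>R r j)"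
    unfolding scaleR_sum_right sum_subtractf[symmetric] using insert.hyps
    by (intro sum.cong refl) (auto simp: c'_def algebra_simps)
  then have res: "v - (\<Sum>j\<in>insert k I. c' j *\<^sub>R r j) = q - t *\<^sub>R p"
    using insert.hyps by (simp add: c'_def p_def q_def algebra_simps)
  have orth_I: "(q - t *\<^sub>R p) \<bullet> r i = 0" if "i \<in> I" for i
    using c[OF that] d[OF that] by (simp add: p_def q_def inner_diff_left)
  moreover have "(q - t *\<^sub>R p) \<bullet> p = 0"
    by (cases "p = 0") (simp_all add: t_def inner_diff_left)
  moreover have "(q - t *\<^sub>R p) \<bullet> (\<Sum>j\<in>I. d j *\<^sub>R r j) = 0"
    by (simp add: inner_sum_right orth_I)
  ultimately have "(q - t *\<^sub>R p) \<bullet> r i = 0" if "i \<in> insert k I" for i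
    using that by (auto simp: p_def inner_diff_right)
  then show ?case unfolding res[symmetric] by blast
qed simp

text \<open>By Pythagoras \<open>(norm (P k - P j))\<^sup>2\<close> is the difference of the squared norms, and these are
  increasing and bounded.\<close>

lemma convergent_of_increasing_projections:
  fixes P :: "nat \<Rightarrow> 'u::{real_inner,banach}"
  assumes orth: "\<And>j k. j \<le> k \<Longrightarrow> P j \<bullet> (P k - P j) = 0" and bound: "\<And>j. norm (P j) \<le> B"
  shows "convergent P"
proof -
  have pyth: "(norm (P k - P j))\<^sup>2 = (norm (P k))\<^sup>2 - (norm (P j))\<^sup>2" if "j \<le> k" for j k
    using orth[OF that]
    by (simp add: power2_norm_eq_inner inner_diff inner_commute algebra_simps)
  have mono: "incseq (\<lambda>j. (norm (P j))\<^sup>2)"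
    unfolding incseq_def using pyth zero_le_power2 by (metis diff_ge_0_iff_ge)
  have "(norm (P j))\<^sup>2 \<le> B\<^sup>2" for j using bound[of j] by (simp add: power_mono)
  then obtain s where s: "(\<lambda>j. (norm (P j))\<^sup>2) \<longlonglongrightarrow> s" "\<And>j. (norm (P j))\<^sup>2 \<le> s"
    using incseq_convergent[OF mono] by metis
  have "Cauchy P"
  proof (rule Cauchy_if_norm_diff_square_le)
    show "(norm (P k - P j))\<^sup>2 \<le> s - (norm (P j))\<^sup>2" if "j \<le> k" for j k
      using pyth[OF that] s(2)[of k] by linarith
    show "(\<lambda>j. s - (norm (P j))\<^sup>2) \<longlonglongrightarrow> 0" using tendsto_diff[OF tendsto_const s(1), of s] by simp
  qed
  then show ?thesis by (simp add: Cauchy_convergent_iff)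
qed

section \<open>Fourier uniqueness and independence\<close>

text \<open>Adding to the constant density \<open>1\<close> a small multiple of \<open>f\<close> gives another probability measure,
  as the case \<open>t = 0\<close> says that \<open>f\<close> has mean \<open>0\<close>.
  By assumption the distributions of \<open>X\<close> under both measures have the same characteristic function,
  so that they agree by the uniqueness theorem of Levy.\<close>

lemma (in prob_space) Fourier_zero_real:
  fixes f :: "'a \<Rightarrow> real"
  assumes [measurable]: "f \<in> borel_measurable M" "X \<in> borel_measurable M" "A \<in> sets borel"
    and C: "\<And>w. \<bar>f w\<bar> \<le> C"
    and zero: "\<And>t. (CLINT w|M. of_real (f w) * iexp (t * X w)) = 0"
  shows "(LINT w|M. f w * indicator A (X w)) = 0"
proof -
  define D where "D = C + 1"
  have "0 \<le> C" using C[of undefined] by linarith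
  then have D: "D > 0" "\<And>w. \<bar>f w\<bar> \<le> D" using order_trans[OF C, of D] unfolding D_def by auto
  define g where "g w = 1 + f w / D" for w
  have g_meas[measurable]: "g \<in> borel_measurable M" unfolding g_def by simp
  have g0: "0 \<le> g w" for w using D(2)[of w] D(1) by (simp add: g_def field_simps abs_le_iff)
  have int_f: "integrable M (\<lambda>w. f w * h w)" if [measurable]: "h \<in> borel_measurable M"
    and "\<And>w. \<bar>h w\<bar> \<le> 1" for h :: "'a \<Rightarrow> real"
    by (rule integrable_const_bound[where B="C"])
       (use C mult_mono[OF C that(2)] \<open>0 \<le> C\<close> in \<open>auto simp: abs_mult\<close>)
  have int_fc: "integrable M (\<lambda>w. of_real (f w) * iexp (t * X w))" for t
    by (rule integrable_const_bound[where B="C"]) (use C in \<open>auto simp: norm_mult\<close>)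
  have int_e: "integrable M (\<lambda>w. iexp (t * X w))" for t
    by (rule integrable_const_bound[where B=1]) auto
  have "(CLINT w|M. of_real (f w)) = 0" using zero[of 0] by simp
  then have Ef: "(LINT w|M. f w) = 0" by simp
  have int_f1: "integrable M f" using int_f[of "\<lambda>_. 1"] by simp
  have Eg: "(LINT w|M. g w) = 1" unfolding g_def using int_f1 Ef by (simp add: prob_space)
  have int_g: "integrable M g" unfolding g_def using int_f1 by simp
  define P where "P = density M (\<lambda>w. ennreal (g w))"
  interpret P: prob_space P
  proof
    show "emeasure P (space P) = 1"
      unfolding P_def using nn_integral_eq_integral[OF int_g] g0 Eg
      by (simp add: emeasure_density cong: nn_integral_cong)
  qed
  have [measurable]: "X \<in> borel_measurable P" unfolding P_def by simp
  interpret X1: real_distribution "distr P borel X" by (rule P.real_distribution_distr) simp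
  interpret X2: real_distribution "distr M borel X" by (rule real_distribution_distr) simp
  have "char (distr P borel X) t = char (distr M borel X) t" for t
  proof -
    have "char (distr P borel X) t = (CLINT w|M. g w *\<^sub>R iexp (t * X w))"
      unfolding char_def P_def by (simp add: integral_distr integral_density g0)
    also have "\<dots> = (CLINT w|M. iexp (t * X w) + (of_real (f w) * iexp (t * X w)) / of_real D)"
      by (intro Bochner_Integration.integral_cong refl) (simp add: g_def scaleR_conv_of_real algebra_simps)
    also have "\<dots> = (CLINT w|M. iexp (t * X w)) + (CLINT w|M. of_real (f w) * iexp (t * X w)) / of_real D"
      using int_e[of t] int_fc[of t] by simp
    also have "\<dots> = char (distr M borel X) t" using zero[of t] by (simp add: char_def integral_distr)
    finally show ?thesis .
  qed
  then have eq: "distr P borel X = distr M borel X"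
    by (intro Levy_uniqueness) (auto intro!: ext simp: X1.real_distribution_axioms X2.real_distribution_axioms)
  have "(LINT w|P. indicator A (X w) :: real) = (LINT x|distr P borel X. indicator A x)"
    by (rule integral_distr[symmetric]) simp_all
  also have "\<dots> = (LINT w|M. indicator A (X w))"
    unfolding eq by (rule integral_distr) simp_all
  also have "(LINT w|P. indicator A (X w)) = (LINT w|M. g w * indicator A (X w) :: real)"
    unfolding P_def by (simp add: integral_density g0)
  also have "\<dots> = (LINT w|M. indicator A (X w) + f w * indicator A (X w) / D)"
    by (intro Bochner_Integration.integral_cong refl) (simp add: g_def algebra_simps)
  also have "\<dots> = (LINT w|M. indicator A (X w)) + (LINT w|M. f w * indicator A (X w)) / D"
    using int_f[of "\<lambda>w. indicator A (X w)"]
    by (subst Bochner_Integration.integral_add)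
       (auto intro!: integrable_const_bound[where B=1] simp: indicator_def)
  finally show ?thesis using D by simp
qed

text \<open>Complex weights reduce to real ones, because the assumption passes to the complex conjugate of
  \<open>f\<close> (replace \<open>t\<close> by \<open>- t\<close>). They are what makes the following induction on the number of variables
  work.\<close>

lemma (in prob_space) Fourier_zero:
  fixes f :: "'a \<Rightarrow> complex"
  assumes [measurable]: "f \<in> borel_measurable M" "X \<in> borel_measurable M" "A \<in> sets borel"
    and C: "\<And>w. norm (f w) \<le> C"
    and zero: "\<And>t. (CLINT w|M. f w * iexp (t * X w)) = 0"
  shows "(CLINT w|M. f w * indicator A (X w)) = 0"
proof -
  have int: "integrable M (\<lambda>w. f w * iexp (t * X w))" for t
    by (rule integrable_const_bound[where B="C"]) (use C in \<open>auto simp: norm_mult\<close>)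
  have zero': "(CLINT w|M. cnj (f w) * iexp (t * X w)) = 0" for t
  proof -
    have "(CLINT w|M. cnj (f w) * iexp (t * X w)) = (CLINT w|M. cnj (f w * iexp (- t * X w)))"
      by (intro Bochner_Integration.integral_cong refl) (simp add: exp_cnj)
    also have "\<dots> = 0" by (subst Bochner_Integration.integral_cnj) (simp only: zero complex_cnj_zero)
    finally show ?thesis .
  qed
  have [measurable]: "(\<lambda>w. cnj (f w)) \<in> borel_measurable M"
    using assms(1) by (rule borel_measurable_continuous_on[OF continuous_on_cnj[OF continuous_on_id]])
  have int': "integrable M (\<lambda>w. cnj (f w) * iexp (t * X w))" for t
    by (rule integrable_const_bound[where B="C"]) (use C in \<open>auto simp: norm_mult\<close>)
  have re: "(CLINT w|M. of_real (Re (f w)) * iexp (t * X w)) = 0" for t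
  proof -
    have "(CLINT w|M. of_real (Re (f w)) * iexp (t * X w)) =
        (CLINT w|M. (f w * iexp (t * X w) + cnj (f w) * iexp (t * X w)) / 2)"
      by (intro Bochner_Integration.integral_cong refl)
         (simp add: distrib_right[symmetric] complex_add_cnj)
    then show ?thesis using int[of t] int'[of t] zero[of t] zero'[of t] by simp
  qed
  have Im_eq: "of_real (Im z) = (z - cnj z) / (2 * \<i>)" for z by (simp add: complex_eq_iff)
  have im: "(CLINT w|M. of_real (Im (f w)) * iexp (t * X w)) = 0" for t
  proof -
    have "(CLINT w|M. of_real (Im (f w)) * iexp (t * X w)) =
        (CLINT w|M. (f w * iexp (t * X w) - cnj (f w) * iexp (t * X w)) / (2 * \<i>))"
      unfolding Im_eq by (intro Bochner_Integration.integral_cong refl) (simp add: left_diff_distrib)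
    then show ?thesis using int[of t] int'[of t] zero[of t] zero'[of t] by simp
  qed
  have bR: "\<bar>Re (f w)\<bar> \<le> C" and bI: "\<bar>Im (f w)\<bar> \<le> C" for w
    using abs_Re_le_cmod[of "f w"] abs_Im_le_cmod[of "f w"] C[of w] by linarith+
  have intA: "integrable M (\<lambda>w. f w * indicator A (X w))"
    by (rule integrable_const_bound[where B="C"])
       (use C order_trans[OF norm_ge_zero C] in \<open>auto simp: norm_mult indicator_def\<close>)
  have "Re (CLINT w|M. f w * indicator A (X w)) = (LINT w|M. Re (f w * indicator A (X w)))"
    by (rule integral_Re[OF intA, symmetric])
  also have "\<dots> = (LINT w|M. Re (f w) * indicator A (X w))"
    by (intro Bochner_Integration.integral_cong refl) (simp add: indicator_def)
  also have "\<dots> = 0" by (rule Fourier_zero_real[OF _ _ _ bR re]) simp_all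
  finally have R: "Re (CLINT w|M. f w * indicator A (X w)) = 0" .
  have "Im (CLINT w|M. f w * indicator A (X w)) = (LINT w|M. Im (f w * indicator A (X w)))"
    by (rule integral_Im[OF intA, symmetric])
  also have "\<dots> = (LINT w|M. Im (f w) * indicator A (X w))"
    by (intro Bochner_Integration.integral_cong refl) (simp add: indicator_def)
  also have "\<dots> = 0" by (rule Fourier_zero_real[OF _ _ _ bI im]) simp_all
  finally show ?thesis using R by (simp add: complex_eq_iff)
qed

text \<open>Uniqueness of multivariate characteristic functions from the univariate case: the exponential in
  one variable is moved into the weight, and the indicator functions of the other variables then
  join the weight in turn.\<close>

lemma (in prob_space) Fourier_zero_box:
  fixes f :: "'a \<Rightarrow> complex"
  assumes "finite I" and "f \<in> borel_measurable M" and C: "\<And>w. norm (f w) \<le> C"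
    and Y[measurable]: "\<And>i. i \<in> I \<Longrightarrow> Y i \<in> borel_measurable M"
    and A[measurable]: "\<And>i. i \<in> I \<Longrightarrow> A i \<in> sets borel"
    and zero: "\<And>b. (CLINT w|M. f w * iexp (\<Sum>i\<in>I. b i * Y i w)) = 0"
  shows "(CLINT w|M. f w * (\<Prod>i\<in>I. indicator (A i) (Y i w))) = 0"
  using assms
proof (induction I arbitrary: f rule: finite_induct)
  case empty
  then show ?case by simp
next
  case (insert k I)
  note [measurable] = insert.prems(1,3,4)
  have "(CLINT w|M. (f w * iexp (t * Y k w)) * (\<Prod>i\<in>I. indicator (A i) (Y i w))) = 0" for t
  proof (rule insert.IH)
    fix b :: "'b \<Rightarrow> real"
    define b' where "b' = b(k := t)"
    have "(\<Sum>i\<in>insert k I. b' i * Y i w) = t * Y k w + (\<Sum>i\<in>I. b i * Y i w)" for w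
      using insert.hyps by (auto simp: b'_def intro!: sum.cong)
    then show "(CLINT w|M. (f w * iexp (t * Y k w)) * iexp (\<Sum>i\<in>I. b i * Y i w)) = 0"
      using insert.prems(5)[of b'] by (simp add: exp_add distrib_left mult.assoc)
  next
    have [measurable]: "Y k \<in> borel_measurable M" using insert.prems by simp
    show "(\<lambda>w. f w * iexp (t * Y k w)) \<in> borel_measurable M" by measurable
  qed (use insert.prems in \<open>auto simp: norm_mult\<close>)
  then have *: "(CLINT w|M. (f w * (\<Prod>i\<in>I. indicator (A i) (Y i w))) * iexp (t * Y k w)) = 0" for t
    by (simp add: mult_ac)
  have "(CLINT w|M. (f w * (\<Prod>i\<in>I. indicator (A i) (Y i w))) * indicator (A k) (Y k w)) = 0"
  proof (rule Fourier_zero[OF _ _ _ _ *])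
    have [measurable]: "\<And>i. i \<in> I \<Longrightarrow> (\<lambda>w. indicator (A i) (Y i w) :: complex) \<in> borel_measurable M"
      using insert.prems by simp
    show "(\<lambda>w. f w * (\<Prod>i\<in>I. indicator (A i) (Y i w))) \<in> borel_measurable M" by measurable
    have "norm (\<Prod>i\<in>I. indicator (A i) (Y i w) :: complex) \<le> 1" for w
      unfolding prod_norm[symmetric] by (rule prod_le_1) (auto simp: indicator_def)
    then show "norm (f w * (\<Prod>i\<in>I. indicator (A i) (Y i w))) \<le> C" for w
      unfolding norm_mult using insert.prems(2)[of w]
      by (meson mult_right_le_one_le norm_ge_zero order_trans)
  qed (use insert.prems in auto)
  then show ?case using insert.hyps by (simp add: mult_ac)
qed

text \<open>Kac's criterion for independence, stated for a real variable and a random vector as an equality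
  of the joint distribution with the product. The first application of Fourier uniqueness, in \<open>Z\<close>,
  replaces the exponential in \<open>Z\<close> by an indicator function; the second one does the same for \<open>Y\<close>.\<close>

lemma (in prob_space) joint_distr_eq_product_if_char_factors:
  assumes I: "finite I"
    and Z[measurable]: "Z \<in> borel_measurable M"
    and Y: "\<And>i. i \<in> I \<Longrightarrow> Y i \<in> borel_measurable M"
    and factor: "\<And>t b. (CLINT w|M. iexp (t * Z w + (\<Sum>i\<in>I. b i * Y i w))) =
        (CLINT w|M. iexp (t * Z w)) * (CLINT w|M. iexp (\<Sum>i\<in>I. b i * Y i w))"
  shows "distr M borel Z \<Otimes>\<^sub>M distr M (\<Pi>\<^sub>M i\<in>I. borel) (\<lambda>w. \<lambda>i\<in>I. Y i w) =
    distr M (borel \<Otimes>\<^sub>M (\<Pi>\<^sub>M i\<in>I. borel)) (\<lambda>w. (Z w, \<lambda>i\<in>I. Y i w))"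
proof -
  note Y[measurable]
  let ?N = "\<Pi>\<^sub>M i\<in>I. (borel :: real measure)"
  let ?Y = "\<lambda>w. \<lambda>i\<in>I. Y i w"
  have Ym[measurable]: "?Y \<in> M \<rightarrow>\<^sub>M ?N" by simp
  have fac1: "(CLINT w|M. (indicator A (Z w) - of_real (prob (Z -` A \<inter> space M))) *
      iexp (\<Sum>i\<in>I. b i * Y i w)) = 0" if [measurable]: "A \<in> sets borel" for A b
  proof -
    define m where "m = (CLINT w|M. iexp (\<Sum>i\<in>I. b i * Y i w))"
    have [measurable]: "(\<lambda>w. iexp (\<Sum>i\<in>I. b i * Y i w)) \<in> borel_measurable M" by measurable
    have int1: "integrable M (\<lambda>w. iexp (\<Sum>i\<in>I. b i * Y i w) * iexp (t * Z w))" for t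
      by (rule integrable_const_bound[where B=1]) (auto simp: norm_mult)
    have int2: "integrable M (\<lambda>w. iexp (t * Z w))" for t
      by (rule integrable_const_bound[where B=1]) auto
    have int3: "integrable M (\<lambda>w. iexp (\<Sum>i\<in>I. b i * Y i w))"
      by (rule integrable_const_bound[where B=1]) auto
    have int4: "integrable M (\<lambda>w. indicator A (Z w) :: complex)"
      by (rule integrable_const_bound[where B=1]) (auto simp: indicator_def)
    have int5: "integrable M (\<lambda>w. indicator A (Z w) * iexp (\<Sum>i\<in>I. b i * Y i w))"
      by (rule integrable_const_bound[where B=1]) (auto simp: norm_mult indicator_def)
    have "(CLINT w|M. (iexp (\<Sum>i\<in>I. b i * Y i w) - m) * indicator A (Z w)) = 0"
    proof (rule Fourier_zero)
      have "norm m \<le> 1" unfolding m_def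
        by (rule order_trans[OF integral_norm_bound]) (simp add: prob_space)
      then show "norm (iexp (\<Sum>i\<in>I. b i * Y i w) - m) \<le> 2" for w
        using norm_triangle_ineq4[of "iexp (\<Sum>i\<in>I. b i * Y i w)" m] by simp
      fix t
      have "(CLINT w|M. (iexp (\<Sum>i\<in>I. b i * Y i w) - m) * iexp (t * Z w)) =
          (CLINT w|M. iexp (\<Sum>i\<in>I. b i * Y i w) * iexp (t * Z w)) - m * (CLINT w|M. iexp (t * Z w))"
        unfolding left_diff_distrib using int1 int2 by simp
      also have "(\<lambda>w. iexp (\<Sum>i\<in>I. b i * Y i w) * iexp (t * Z w)) =
          (\<lambda>w. iexp (t * Z w + (\<Sum>i\<in>I. b i * Y i w)))"
        by (simp add: exp_add distrib_left mult.commute)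
      also have "(CLINT w|M. iexp (t * Z w + (\<Sum>i\<in>I. b i * Y i w))) - m * (CLINT w|M. iexp (t * Z w)) = 0"
        unfolding factor m_def by simp
      finally show "(CLINT w|M. (iexp (\<Sum>i\<in>I. b i * Y i w) - m) * iexp (t * Z w)) = 0" .
    qed measurable
    then have "(CLINT w|M. indicator A (Z w) * iexp (\<Sum>i\<in>I. b i * Y i w) - m * indicator A (Z w)) = 0"
      by (simp add: algebra_simps)
    then have *: "(CLINT w|M. indicator A (Z w) * iexp (\<Sum>i\<in>I. b i * Y i w)) =
        m * (CLINT w|M. indicator A (Z w))"
      using int4 int5 by simp
    have "(CLINT w|M. indicator A (Z w)) = (CLINT w|M. of_real (indicator (Z -` A \<inter> space M) w))"
      by (intro Bochner_Integration.integral_cong refl) (simp add: indicator_def)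
    also have "\<dots> = of_real (prob (Z -` A \<inter> space M))" by simp
    finally have P: "(CLINT w|M. indicator A (Z w)) = of_real (prob (Z -` A \<inter> space M))" .
    show ?thesis unfolding left_diff_distrib using int3 int5 * P by (simp add: m_def)
  qed
  have box: "emeasure M {w\<in>space M. Z w \<in> A \<and> ?Y w \<in> Pi\<^sub>E I B} =
      emeasure M (Z -` A \<inter> space M) * emeasure M (?Y -` (Pi\<^sub>E I B) \<inter> space M)"
    if A[measurable]: "A \<in> sets borel" and B[measurable]: "\<And>i. i \<in> I \<Longrightarrow> B i \<in> sets borel" for A B
  proof -
    have ind: "(\<Prod>i\<in>I. indicator (B i) (Y i w)) = (indicator (Pi\<^sub>E I B) (?Y w) :: complex)" for w
      using I by (auto simp: indicator_def PiE_iff prod_zero_iff)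
    have BB[measurable]: "Pi\<^sub>E I B \<in> sets ?N" using I B by (intro sets_PiM_I_finite) auto
    have "(CLINT w|M. (indicator A (Z w) - of_real (prob (Z -` A \<inter> space M))) *
        (\<Prod>i\<in>I. indicator (B i) (Y i w))) = 0"
    proof (rule Fourier_zero_box[OF I _ _ Y B fac1[OF A]])
      show "norm (indicator A (Z w) - of_real (prob (Z -` A \<inter> space M)) :: complex) \<le> 2" for w
        by (rule order_trans[OF norm_triangle_ineq4]) (auto simp: indicator_def intro: order_trans[OF prob_le_1])
    qed auto
    then have "(CLINT w|M. indicator A (Z w) * indicator (Pi\<^sub>E I B) (?Y w) -
        of_real (prob (Z -` A \<inter> space M)) * indicator (Pi\<^sub>E I B) (?Y w)) = 0"
      unfolding ind by (simp add: left_diff_distrib)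
    then have "(CLINT w|M. of_real (indicator {w\<in>space M. Z w \<in> A \<and> ?Y w \<in> Pi\<^sub>E I B} w) -
        of_real (prob (Z -` A \<inter> space M)) * of_real (indicator (?Y -` (Pi\<^sub>E I B) \<inter> space M) w)) = 0"
      by (subst (asm) Bochner_Integration.integral_cong[OF refl]) (auto simp: indicator_def)
    then have "(CLINT w|M. complex_of_real (indicator {w\<in>space M. Z w \<in> A \<and> ?Y w \<in> Pi\<^sub>E I B} w -
        prob (Z -` A \<inter> space M) * indicator (?Y -` (Pi\<^sub>E I B) \<inter> space M) w)) = 0"
      by simp
    then have "(LINT w|M. indicator {w\<in>space M. Z w \<in> A \<and> ?Y w \<in> Pi\<^sub>E I B} w -
        prob (Z -` A \<inter> space M) * indicator (?Y -` (Pi\<^sub>E I B) \<inter> space M) w) = 0"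
      by (subst (asm) integral_complex_of_real) (simp only: of_real_eq_0_iff)
    moreover have "{w\<in>space M. Z w \<in> A \<and> ?Y w \<in> Pi\<^sub>E I B} \<in> sets M" by measurable
    ultimately have "prob {w\<in>space M. Z w \<in> A \<and> ?Y w \<in> Pi\<^sub>E I B} =
        prob (Z -` A \<inter> space M) * prob (?Y -` (Pi\<^sub>E I B) \<inter> space M)"
      by (subst (asm) Bochner_Integration.integral_diff)
         (auto simp: less_top[symmetric] Int_absorb2 sets.sets_into_space simp del: restrict_PiE_iff PiE_restrict)
    then show ?thesis by (simp add: emeasure_eq_measure ennreal_mult)
  qed
  have all: "emeasure M {w\<in>space M. Z w \<in> A \<and> ?Y w \<in> B} =
      emeasure M (Z -` A \<inter> space M) * emeasure M (?Y -` B \<inter> space M)"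
    if A[measurable]: "A \<in> sets borel" and B[measurable]: "B \<in> sets ?N" for A B
  proof -
    define P where "P = distr (density M (indicator (Z -` A \<inter> space M))) ?N ?Y"
    define Q where "Q = distr (density M (\<lambda>_. emeasure M (Z -` A \<inter> space M))) ?N ?Y"
    have Pe: "emeasure P C = emeasure M {w\<in>space M. Z w \<in> A \<and> ?Y w \<in> C}"
      if [measurable]: "C \<in> sets ?N" for C
    proof -
      have "emeasure P C = emeasure M ((Z -` A \<inter> space M) \<inter> (?Y -` C \<inter> space M))"
        unfolding P_def by (simp add: emeasure_distr emeasure_restricted)
      also have "(Z -` A \<inter> space M) \<inter> (?Y -` C \<inter> space M) = {w\<in>space M. Z w \<in> A \<and> ?Y w \<in> C}" by auto
      finally show ?thesis .
    qed
    have Qe: "emeasure Q C = emeasure M (Z -` A \<inter> space M) * emeasure M (?Y -` C \<inter> space M)"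
      if [measurable]: "C \<in> sets ?N" for C
      unfolding Q_def by (simp add: emeasure_distr emeasure_density nn_integral_cmult)
    have "P = Q"
    proof (rule measure_eqI_PiM_finite[OF I, where A="\<lambda>_. Pi\<^sub>E I (\<lambda>_. UNIV)"])
      show "sets P = sets ?N" "sets Q = sets ?N" by (simp_all add: P_def Q_def)
      show "emeasure P (Pi\<^sub>E I B) = emeasure Q (Pi\<^sub>E I B)" if "\<And>i. i \<in> I \<Longrightarrow> B i \<in> sets borel" for B
      proof -
        have "Pi\<^sub>E I B \<in> sets ?N" using I that by (intro sets_PiM_I_finite) auto
        then show ?thesis using box[OF A that] by (simp add: Pe Qe)
      qed
      have "Pi\<^sub>E I (\<lambda>_. UNIV) \<in> sets ?N" using I by (intro sets_PiM_I_finite) auto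
      then show "emeasure P (Pi\<^sub>E I (\<lambda>_. UNIV)) \<noteq> \<infinity>" by (simp add: Pe)
    qed (use I in \<open>auto simp: space_PiM intro!: prod_algebraI_finite\<close>)
    then show ?thesis using Pe[OF B] Qe[OF B] by simp
  qed
  interpret Zd: prob_space "distr M borel Z" by (rule prob_space_distr) simp
  interpret Yd: prob_space "distr M ?N ?Y" by (rule prob_space_distr) simp
  show "distr M borel Z \<Otimes>\<^sub>M distr M ?N ?Y = distr M (borel \<Otimes>\<^sub>M ?N) (\<lambda>w. (Z w, ?Y w))"
  proof (rule pair_measure_eqI)
    fix A B assume "A \<in> sets (distr M borel Z)" "B \<in> sets (distr M ?N ?Y)"
    then have [measurable]: "A \<in> sets borel" "B \<in> sets ?N" by auto
    have "emeasure (distr M (borel \<Otimes>\<^sub>M ?N) (\<lambda>w. (Z w, ?Y w))) (A \<times> B) =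
        emeasure M ((\<lambda>w. (Z w, ?Y w)) -` (A \<times> B) \<inter> space M)"
      by (rule emeasure_distr) measurable
    also have "(\<lambda>w. (Z w, ?Y w)) -` (A \<times> B) \<inter> space M = {w\<in>space M. Z w \<in> A \<and> ?Y w \<in> B}" by auto
    also have "emeasure M \<dots> = emeasure M (Z -` A \<inter> space M) * emeasure M (?Y -` B \<inter> space M)"
      by (rule all) measurable
    finally show "emeasure (distr M borel Z) A * emeasure (distr M ?N ?Y) B =
        emeasure (distr M (borel \<Otimes>\<^sub>M ?N) (\<lambda>w. (Z w, ?Y w))) (A \<times> B)"
      by (simp only: emeasure_distr[OF Z \<open>A \<in> sets borel\<close>] emeasure_distr[OF Ym \<open>B \<in> sets ?N\<close>])
  qed (auto intro: Zd.sigma_finite_measure_axioms Yd.sigma_finite_measure_axioms sets_pair_measure_cong)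
qed

section \<open>Uniqueness of weakly continuous conditional distributions\<close>

lemma real_distribution_if_in_prob_algebra:
  "N \<in> space (prob_algebra borel) \<Longrightarrow> real_distribution N"
  by (auto simp: space_prob_algebra real_distribution_def real_distribution_axioms_def)

lemma cond_distribution_real_distribution:
  assumes "cond_distribution M X N Y \<kappa>" "y \<in> space N"
  shows "real_distribution (\<kappa> y)"
proof (rule real_distribution_if_in_prob_algebra)
  have "\<kappa> \<in> N \<rightarrow>\<^sub>M prob_algebra borel" using assms(1) by (simp add: cond_distribution_def)
  then show "\<kappa> y \<in> space (prob_algebra borel)" using assms(2) by (rule measurable_space)
qed

lemma real_distribution_eqI_rationals:
  assumes "real_distribution P" "real_distribution Q"
    and eq: "\<And>q. q \<in> \<rat> \<Longrightarrow> measure P {..q} = measure Q {..q}"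
  shows "P = Q"
proof -
  have le: "cdf P x \<le> cdf Q x" if "real_distribution P" "real_distribution Q"
      and eq: "\<And>q. q \<in> \<rat> \<Longrightarrow> cdf P q = cdf Q q" for P Q x
  proof (rule ccontr)
    interpret P: real_distribution P by fact
    interpret Q: real_distribution Q by fact
    assume "\<not> cdf P x \<le> cdf Q x"
    moreover have "(cdf Q \<longlongrightarrow> cdf Q x) (at_right x)"
      using Q.cdf_is_right_cont[of x] by (simp add: continuous_within)
    ultimately have "eventually (\<lambda>z. cdf Q z < cdf P x) (at_right x)"
      by (intro order_tendstoD(2)) auto
    then obtain b where b: "x < b" "\<And>z. x < z \<Longrightarrow> z < b \<Longrightarrow> cdf Q z < cdf P x"
      unfolding eventually_at_right_field by auto
    obtain q where q: "q \<in> \<rat>" "x < q" "q < b" using Rats_dense_in_real[OF b(1)] by auto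
    have "cdf P x \<le> cdf P q" using q by (intro P.cdf_nondecreasing) simp
    then show False using b(2)[OF q(2,3)] eq[OF q(1)] by simp
  qed
  have "cdf P = cdf Q"
    using le[OF assms(1,2)] le[OF assms(2,1)] eq by (intro ext antisym) (simp_all add: cdf_def)
  then show ?thesis using assms cdf_unique by blast
qed

text \<open>Countably many half lines determine a distribution on the real line, and for each of them the
  two kernels have the same integrals over all events in \<open>Y\<close>.\<close>

lemma (in prob_space) cond_distribution_AE_unique:
  assumes Y[measurable]: "Y \<in> M \<rightarrow>\<^sub>M N"
    and \<kappa>: "cond_distribution M X N Y \<kappa>" and \<kappa>': "cond_distribution M X N Y \<kappa>'"
  shows "AE w in M. \<kappa> (Y w) = \<kappa>' (Y w)"
proof -
  interpret D: prob_space "distr M N Y" by (rule prob_space_distr) simp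
  have [measurable]: "\<kappa> \<in> N \<rightarrow>\<^sub>M prob_algebra borel" "\<kappa>' \<in> N \<rightarrow>\<^sub>M prob_algebra borel"
    using \<kappa> \<kappa>' by (auto simp: cond_distribution_def)
  have real_d: "real_distribution (\<kappa> y)" "real_distribution (\<kappa>' y)" if "y \<in> space N" for y
    using cond_distribution_real_distribution[OF \<kappa> that] cond_distribution_real_distribution[OF \<kappa>' that]
    by simp_all
  have "AE y in distr M N Y. measure (\<kappa> y) {..q} = measure (\<kappa>' y) {..q}" for q
  proof (rule density_unique_real)
    have le1: "AE y in distr M N Y. measure (\<kappa> y) {..q} \<le> 1" "AE y in distr M N Y. measure (\<kappa>' y) {..q} \<le> 1"
      using real_d by (auto simp: real_distribution_def intro!: AE_I2 prob_space.prob_le_1)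
    show "integrable (distr M N Y) (\<lambda>y. measure (\<kappa> y) {..q})"
      using le1(1) by (intro D.integrable_const_bound[where B=1]) auto
    show "integrable (distr M N Y) (\<lambda>y. measure (\<kappa>' y) {..q})"
      using le1(2) by (intro D.integrable_const_bound[where B=1]) auto
    fix B assume "B \<in> sets (distr M N Y)"
    then have "B \<in> sets N" by simp
    then show "(LINT y:B|distr M N Y. measure (\<kappa> y) {..q}) = (LINT y:B|distr M N Y. measure (\<kappa>' y) {..q})"
      using \<kappa> \<kappa>' by (simp add: cond_distribution_def)
  qed
  then have "AE y in distr M N Y. \<forall>q\<in>\<rat>. measure (\<kappa> y) {..q} = measure (\<kappa>' y) {..q}"
    by (subst AE_ball_countable[OF countable_rat]) simp
  then have "AE w in M. \<forall>q\<in>\<rat>. measure (\<kappa> (Y w)) {..q} = measure (\<kappa>' (Y w)) {..q}"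
    by (rule AE_distrD[OF Y])
  with AE_space show ?thesis
  proof eventually_elim
    case (elim w)
    then have "Y w \<in> space N" using measurable_space[OF Y] by blast
    with elim show ?case by (intro real_distribution_eqI_rationals real_d) auto
  qed
qed

text \<open>The two kernels agree almost surely, and every neighbourhood of \<open>y\<close> is hit with positive
  probability. So \<open>y\<close> is a limit of points at which they agree, and weak continuity carries the
  equality over to \<open>y\<close>.\<close>

lemma (in prob_space) cond_distribution_unique_at_support:
  assumes Y[measurable]: "Y \<in> M \<rightarrow>\<^sub>M (\<Pi>\<^sub>M i\<in>I. borel)"
    and \<kappa>: "cond_distribution M X (\<Pi>\<^sub>M i\<in>I. borel) Y \<kappa>" "weakly_continuous I \<kappa>"
    and \<kappa>': "cond_distribution M X (\<Pi>\<^sub>M i\<in>I. borel) Y \<kappa>'" "weakly_continuous I \<kappa>'"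
    and y: "y \<in> extensional I"
    and support: "\<And>\<epsilon>. \<epsilon> > 0 \<Longrightarrow> prob {w \<in> space M. \<forall>i\<in>I. \<bar>Y w i - y i\<bar> < \<epsilon>} > 0"
  shows "\<kappa> y = \<kappa>' y"
proof -
  let ?N = "\<Pi>\<^sub>M i\<in>I. (borel :: real measure)"
  have real_d: "real_distribution (\<kappa> z)" "real_distribution (\<kappa>' z)" if "z \<in> extensional I" for z
  proof -
    have "z \<in> space ?N" using that by (auto simp: space_PiM PiE_iff)
    then show "real_distribution (\<kappa> z)" "real_distribution (\<kappa>' z)"
      using cond_distribution_real_distribution[OF \<kappa>(1)] cond_distribution_real_distribution[OF \<kappa>'(1)]
      by simp_all
  qed
  have "\<exists>z. z \<in> extensional I \<and> (\<forall>i\<in>I. \<bar>z i - y i\<bar> < 1 / real (Suc n)) \<and> \<kappa> z = \<kappa>' z" for n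
  proof (rule ccontr)
    assume none: "\<not> ?thesis"
    define S where "S = {w \<in> space M. \<forall>i\<in>I. \<bar>Y w i - y i\<bar> < 1 / real (Suc n)}"
    have "AE w in M. w \<notin> S"
      using cond_distribution_AE_unique[OF Y \<kappa>(1) \<kappa>'(1)] AE_space
    proof eventually_elim
      case (elim w)
      then have "Y w \<in> extensional I"
        using measurable_space[OF Y] by (auto simp: space_PiM PiE_iff)
      with elim none show ?case by (auto simp: S_def)
    qed
    moreover have "prob S > 0"
      unfolding S_def by (rule support) simp
    moreover from this have "S \<in> events"
      by (rule contrapos_pp) (simp only: measure_notin_sets less_irrefl not_False_eq_True)
    ultimately show False using prob_eq_0[of S] by simp
  qed
  then obtain z where z: "\<And>n. z n \<in> extensional I" "\<And>n i. i \<in> I \<Longrightarrow> \<bar>z n i - y i\<bar> < 1 / real (Suc n)"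
      "\<And>n. \<kappa> (z n) = \<kappa>' (z n)" by metis
  have "(\<lambda>n. z n i) \<longlonglongrightarrow> y i" if "i \<in> I" for i
  proof (rule LIMSEQ_I)
    fix r :: real assume "0 < r"
    then obtain N where N: "1 / real (Suc N) < r" using nat_approx_posE by blast
    have "norm (z n i - y i) < r" if "n \<ge> N" for n
    proof -
      have "1 / real (Suc n) \<le> 1 / real (Suc N)" using that by (simp add: frac_le)
      then show ?thesis using z(2)[OF \<open>i \<in> I\<close>, of n] N by simp
    qed
    then show "\<exists>no. \<forall>n\<ge>no. norm (z n i - y i) < r" by blast
  qed
  with z(1) y have z_conv: "(\<forall>n. z n \<in> extensional I) \<and> y \<in> extensional I \<and>
      (\<forall>i\<in>I. (\<lambda>n. z n i) \<longlonglongrightarrow> y i)" by simp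
  have conv: "weak_conv_m (\<lambda>n. \<kappa> (z n)) (\<kappa> y)"
    using \<kappa>(2) z_conv unfolding weakly_continuous_def by simp
  have conv': "weak_conv_m (\<lambda>n. \<kappa> (z n)) (\<kappa>' y)"
    using \<kappa>'(2) z_conv unfolding weakly_continuous_def z(3) by simp
  have "char (\<kappa> y) t = char (\<kappa>' y) t" for t
    by (rule LIMSEQ_unique[OF levy_continuity1[OF _ _ conv] levy_continuity1[OF _ _ conv']])
       (simp_all add: real_d z(1) y)
  then show ?thesis using Levy_uniqueness[OF real_d(1)[OF y] real_d(2)[OF y]] by blast
qed

section \<open>Isonormal Gaussian processes\<close>

text \<open>The Gaussian field after identification of \<open>U\<close> with its dual. Linearity is only required up to a
  null set that may depend on the elements, so each finite linear combination has to be treated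
  almost surely.\<close>

locale isonormal = prob_space M for M :: "'w measure" +
  fixes G :: "'u::real_inner \<Rightarrow> 'w \<Rightarrow> real"
  assumes linear: "AE w in M. G (a *\<^sub>R u + b *\<^sub>R v) w = a * G u w + b * G v w"
    and gaussian: "centred_gaussian M (G u)"
    and variance: "variance (G u) = (norm u)\<^sup>2"
begin

lemma measurable_G[measurable]: "G u \<in> borel_measurable M"
  using gaussian by (simp add: centred_gaussian_def)

lemma G_zero: "AE w in M. G 0 w = 0"
  using linear[of 0 0 0 0] by simp

lemma normal_G:
  assumes "u \<noteq> 0"
  shows "distributed M lborel (G u) (normal_density 0 (norm u))"
proof -
  have "\<not> (AE w in M. G u w = 0)"
  proof
    assume *: "AE w in M. G u w = 0"
    have "expectation (G u) = 0" using * by (simp add: integral_eq_zero_AE)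
    then have "variance (G u) = 0" using * by (simp add: integral_eq_zero_AE)
    then show False using variance[of u] assms by simp
  qed
  then obtain \<sigma> where \<sigma>: "\<sigma> > 0" "distributed M lborel (G u) (normal_density 0 \<sigma>)"
    using gaussian[of u] by (auto simp: centred_gaussian_def)
  have "\<sigma>\<^sup>2 = (norm u)\<^sup>2" using normal_distributed_variance[OF \<sigma>] variance[of u] by simp
  then have "\<sigma> = norm u" using \<sigma>(1) by (simp add: power2_eq_iff_nonneg)
  with \<sigma> show ?thesis by simp
qed

lemma integrable_G: "integrable M (G u)"
proof (cases "u = 0")
  case True
  have "integrable M (G u) \<longleftrightarrow> integrable M (\<lambda>_. 0 :: real)"
    using G_zero True by (intro integrable_cong_AE) auto
  then show ?thesis by simp
next
  case False
  then have "integrable lborel (\<lambda>x. normal_density 0 (norm u) x * x) \<longleftrightarrow> integrable M (\<lambda>w. G u w)"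
    by (intro distributed_integrable[OF normal_G]) auto
  then show ?thesis using False integrable_normal_moment_nz_1[of "norm u" 0] by simp
qed

lemma expectation_G: "expectation (G u) = 0"
proof (cases "u = 0")
  case True
  then show ?thesis using G_zero by (simp add: integral_eq_zero_AE)
next
  case False
  then show ?thesis using normal_distributed_expectation[OF _ normal_G] by simp
qed

lemma char_G: "(CLINT w|M. iexp (G u w)) = exp (- (norm u)\<^sup>2 / 2)"
proof (cases "u = 0")
  case True
  have "(CLINT w|M. iexp (G u w)) = (CLINT w|M. 1)"
    by (rule integral_cong_AE) (use G_zero True in auto)
  then show ?thesis using True by (simp add: prob_space)
next
  case False
  define X where "X w = G u w / norm u" for w
  have [measurable]: "X \<in> borel_measurable M" unfolding X_def by measurable
  have "distributed M lborel X std_normal_density"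
    using normal_G[OF False] False normal_standard_normal_convert[of "norm u" "G u" 0]
    by (simp add: X_def[abs_def])
  then have "distr M lborel X = std_normal_distribution"
    by (rule distributed_distr_eq_density)
  then have "char std_normal_distribution (norm u) = (CLINT w|M. iexp (norm u * X w))"
    unfolding char_def by (subst integral_distr[symmetric, where N=lborel]) simp_all
  then show ?thesis using False by (simp add: X_def char_std_normal_distribution)
qed

lemma G_sum:
  assumes "finite I"
  shows "AE w in M. G (\<Sum>i\<in>I. c i *\<^sub>R r i) w = (\<Sum>i\<in>I. c i * G (r i) w)"
  using assms
proof (induction I rule: finite_induct)
  case empty
  then show ?case using G_zero by simp
next
  case (insert k I)
  show ?case
    using insert.IH linear[of "c k" "r k" 1 "\<Sum>i\<in>I. c i *\<^sub>R r i"]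
    by eventually_elim (use insert.hyps in simp)
qed

text \<open>Every combination \<open>t *\<^sub>R p + q\<close> with \<open>q\<close> in the span of the \<open>r i\<close> is centred Gaussian with variance
  \<open>(norm (t *\<^sub>R p))\<^sup>2 + (norm q)\<^sup>2\<close>, hence the joint characteristic function is a product.\<close>

lemma joint_distr_orthogonal:
  assumes I: "finite I" and orth: "\<And>i. i \<in> I \<Longrightarrow> p \<bullet> r i = 0"
  shows "distr M borel (G p) \<Otimes>\<^sub>M distr M (\<Pi>\<^sub>M i\<in>I. borel) (\<lambda>w. \<lambda>i\<in>I. G (r i) w) =
    distr M (borel \<Otimes>\<^sub>M (\<Pi>\<^sub>M i\<in>I. borel)) (\<lambda>w. (G p w, \<lambda>i\<in>I. G (r i) w))"
proof (rule joint_distr_eq_product_if_char_factors[OF I])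
  fix t :: real and b :: "'a \<Rightarrow> real"
  define q where "q = (\<Sum>i\<in>I. b i *\<^sub>R r i)"
  have "(CLINT w|M. iexp (t * G p w + (\<Sum>i\<in>I. b i * G (r i) w))) = (CLINT w|M. iexp (G (t *\<^sub>R p + 1 *\<^sub>R q) w))"
    by (rule integral_cong_AE, measurable)
       (use G_sum[OF I, of b r] linear[of t p 1 q] in eventually_elim, simp add: q_def)
  also have "\<dots> = exp (- (norm (t *\<^sub>R p + 1 *\<^sub>R q))\<^sup>2 / 2)" by (rule char_G)
  also have "p \<bullet> q = 0" unfolding q_def by (simp add: inner_sum_right orth)
  then have "(norm (t *\<^sub>R p + 1 *\<^sub>R q))\<^sup>2 = (norm (t *\<^sub>R p + 0 *\<^sub>R p))\<^sup>2 + (norm q)\<^sup>2"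
    unfolding power2_norm_eq_inner by (simp add: inner_add inner_commute)
  then have "complex_of_real (exp (- (norm (t *\<^sub>R p + 1 *\<^sub>R q))\<^sup>2 / 2)) =
      exp (- (norm (t *\<^sub>R p + 0 *\<^sub>R p))\<^sup>2 / 2) * exp (- (norm q)\<^sup>2 / 2)"
    by (intro arg_cong[where f=complex_of_real]) (simp add: exp_add[symmetric] add_divide_distrib)
  also have "\<dots> = (CLINT w|M. iexp (G (t *\<^sub>R p + 0 *\<^sub>R p) w)) * (CLINT w|M. iexp (G q w))"
    by (simp only: char_G of_real_mult)
  also have "(CLINT w|M. iexp (G (t *\<^sub>R p + 0 *\<^sub>R p) w)) = (CLINT w|M. iexp (t * G p w))"
    by (rule integral_cong_AE, measurable) (use linear[of t p 0 p] in eventually_elim, simp)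
  also have "(CLINT w|M. iexp (G q w)) = (CLINT w|M. iexp (\<Sum>i\<in>I. b i * G (r i) w))"
    by (rule integral_cong_AE, measurable) (use G_sum[OF I, of b r] in eventually_elim, simp add: q_def)
  finally show "(CLINT w|M. iexp (t * G p w + (\<Sum>i\<in>I. b i * G (r i) w))) =
      (CLINT w|M. iexp (t * G p w)) * (CLINT w|M. iexp (\<Sum>i\<in>I. b i * G (r i) w))" .
qed simp_all

lemma prob_orthogonal:
  assumes I: "finite I" and orth: "\<And>i. i \<in> I \<Longrightarrow> p \<bullet> r i = 0"
    and [measurable]: "A \<in> sets borel" "B \<in> sets (\<Pi>\<^sub>M i\<in>I. borel)"
  shows "prob {w \<in> space M. G p w \<in> A \<and> (\<lambda>i\<in>I. G (r i) w) \<in> B} =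
    prob {w \<in> space M. G p w \<in> A} * prob {w \<in> space M. (\<lambda>i\<in>I. G (r i) w) \<in> B}"
proof -
  let ?N = "\<Pi>\<^sub>M i\<in>I. (borel :: real measure)"
  let ?Y = "\<lambda>w. \<lambda>i\<in>I. G (r i) w"
  interpret Z: prob_space "distr M borel (G p)" by (rule prob_space_distr) simp
  interpret Y: prob_space "distr M ?N ?Y" by (rule prob_space_distr) simp
  have "prob {w \<in> space M. G p w \<in> A \<and> ?Y w \<in> B} = prob ((\<lambda>w. (G p w, ?Y w)) -` (A \<times> B) \<inter> space M)"
    by (rule arg_cong[where f=prob]) auto
  also have "\<dots> = measure (distr M (borel \<Otimes>\<^sub>M ?N) (\<lambda>w. (G p w, ?Y w))) (A \<times> B)"
    by (rule measure_distr[symmetric]) measurable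
  also have "\<dots> = measure (distr M borel (G p) \<Otimes>\<^sub>M distr M ?N ?Y) (A \<times> B)"
    by (rule arg_cong[where f="\<lambda>D. measure D (A \<times> B)"], rule joint_distr_orthogonal[symmetric])
       (fact I, rule orth)
  also have "\<dots> = measure (distr M borel (G p)) A * measure (distr M ?N ?Y) B"
    by (simp add: measure_def Y.emeasure_pair_measure_Times enn2real_mult)
  also have "measure (distr M borel (G p)) A = prob (G p -` A \<inter> space M)"
    by (rule measure_distr) measurable
  also have "G p -` A \<inter> space M = {w \<in> space M. G p w \<in> A}" by auto
  also have "measure (distr M ?N ?Y) B = prob (?Y -` B \<inter> space M)"
    by (rule measure_distr) measurable
  also have "?Y -` B \<inter> space M = {w \<in> space M. ?Y w \<in> B}" by auto
  finally show ?thesis .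
qed

lemma prob_near_pos:
  assumes "\<epsilon> > 0"
  shows "prob {w \<in> space M. \<bar>G u w - v \<bullet> u\<bar> < \<epsilon>} > 0"
proof (cases "u = 0")
  case True
  have "AE w in M. w \<in> {w \<in> space M. \<bar>G u w - v \<bullet> u\<bar> < \<epsilon>}"
    using G_zero AE_space by eventually_elim (use assms True in auto)
  then have "prob {w \<in> space M. \<bar>G u w - v \<bullet> u\<bar> < \<epsilon>} = 1" by (subst prob_eq_1) auto
  then show ?thesis by simp
next
  case False
  let ?a = "v \<bullet> u" and ?J = "{v \<bullet> u - \<epsilon> <..< v \<bullet> u + \<epsilon>}"
  have "{w \<in> space M. \<bar>G u w - ?a\<bar> < \<epsilon>} = G u -` ?J \<inter> space M" by auto
  then have "emeasure M {w \<in> space M. \<bar>G u w - ?a\<bar> < \<epsilon>} =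
      (\<integral>\<^sup>+x. ennreal (normal_density 0 (norm u) x) * indicator ?J x \<partial>lborel)"
    using distributed_emeasure[OF normal_G[OF False], of ?J] by simp
  also have "\<dots> \<noteq> 0"
  proof
    assume "(\<integral>\<^sup>+x. ennreal (normal_density 0 (norm u) x) * indicator ?J x \<partial>lborel) = 0"
    then have "AE x in lborel. ennreal (normal_density 0 (norm u) x) * indicator ?J x = 0"
      by (subst (asm) nn_integral_0_iff_AE) auto
    then have "AE x in lborel. x \<notin> ?J"
    proof eventually_elim
      case (elim x)
      then show ?case using normal_density_pos[of "norm u" 0 x] False
        by (auto simp: indicator_def ennreal_eq_0_iff split: if_splits)
    qed
    then have "emeasure lborel ?J = 0" by (subst (asm) AE_iff_measurable[of ?J]) auto
    then show False using assms by simp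
  qed
  finally show ?thesis by (simp add: emeasure_eq_measure zero_less_measure_iff)
qed

text \<open>The values \<open>v \<bullet> r i\<close> taken by an element \<open>v\<close> lie in the support of the Gaussian vector, even
  when its covariance is singular. In the induction the new variable is a combination of
  the old ones plus an independent Gaussian variable, which is near its target with positive
  probability.\<close>

lemma prob_jointly_near_pos:
  assumes "finite I" "\<epsilon> > 0"
  shows "prob {w \<in> space M. \<forall>i\<in>I. \<bar>G (r i) w - v \<bullet> r i\<bar> < \<epsilon>} > 0"
  using assms
proof (induction I arbitrary: \<epsilon> rule: finite_induct)
  case empty
  then show ?case by (simp add: prob_space)
next
  case (insert k I)
  obtain c where c: "\<And>i. i \<in> I \<Longrightarrow> (r k - (\<Sum>j\<in>I. c j *\<^sub>R r j)) \<bullet> r i = 0"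
    using orthogonal_residual_exists[OF insert.hyps(1), of "r k" r] by blast
  define p where "p = r k - (\<Sum>j\<in>I. c j *\<^sub>R r j)"
  define S where "S = (\<Sum>j\<in>I. \<bar>c j\<bar>)"
  \<comment> \<open>Errors \<open>\<delta>\<close> in the old variables contribute at most \<open>\<delta> * S \<le> \<epsilon> / 2\<close> to the new one.\<close>
  define \<delta> where "\<delta> = min \<epsilon> (\<epsilon> / (2 * (1 + S)))"
  have S: "S \<ge> 0" unfolding S_def by (simp add: sum_nonneg)
  have \<delta>: "\<delta> > 0" "\<delta> \<le> \<epsilon>" unfolding \<delta>_def using S insert.prems by auto
  have \<delta>S: "\<delta> * S \<le> \<epsilon> / 2"
  proof -
    have "\<delta> * S \<le> (\<epsilon> / (2 * (1 + S))) * (1 + S)"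
      unfolding \<delta>_def using S insert.prems by (intro mult_mono) auto
    also have "\<dots> = \<epsilon> / 2" using S by (simp add: field_simps)
    finally show ?thesis .
  qed
  let ?N = "\<Pi>\<^sub>M i\<in>I. (borel :: real measure)"
  let ?A = "{x. \<bar>x - v \<bullet> p\<bar> < \<epsilon> / 2}"
  let ?B = "{y \<in> space ?N. \<forall>i\<in>I. \<bar>y i - v \<bullet> r i\<bar> < \<delta>}"
  have [measurable]: "?A \<in> sets borel" by measurable
  have [measurable]: "?B \<in> sets ?N" using insert.hyps(1) by measurable
  have B_iff: "(\<lambda>i\<in>I. G (r i) w) \<in> ?B \<longleftrightarrow> (\<forall>i\<in>I. \<bar>G (r i) w - v \<bullet> r i\<bar> < \<delta>)" for w
    by (auto simp: space_PiM)
  have "prob {w \<in> space M. G p w \<in> ?A \<and> (\<lambda>i\<in>I. G (r i) w) \<in> ?B} =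
      prob {w \<in> space M. G p w \<in> ?A} * prob {w \<in> space M. (\<lambda>i\<in>I. G (r i) w) \<in> ?B}"
    by (rule prob_orthogonal[OF insert.hyps(1)]) (use c in \<open>simp_all add: p_def\<close>)
  moreover have "prob {w \<in> space M. G p w \<in> ?A} > 0"
    using prob_near_pos[of "\<epsilon> / 2" p v] insert.prems by simp
  moreover have "prob {w \<in> space M. (\<lambda>i\<in>I. G (r i) w) \<in> ?B} > 0"
    unfolding B_iff by (rule insert.IH[OF \<delta>(1)])
  ultimately have "0 < prob {w \<in> space M. G p w \<in> ?A \<and> (\<lambda>i\<in>I. G (r i) w) \<in> ?B}" by simp
  also have "\<dots> \<le> prob {w \<in> space M. \<forall>i\<in>insert k I. \<bar>G (r i) w - v \<bullet> r i\<bar> < \<epsilon>}"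
  proof (rule finite_measure_mono_AE)
    show "AE w in M. w \<in> {w \<in> space M. G p w \<in> ?A \<and> (\<lambda>i\<in>I. G (r i) w) \<in> ?B} \<longrightarrow>
        w \<in> {w \<in> space M. \<forall>i\<in>insert k I. \<bar>G (r i) w - v \<bullet> r i\<bar> < \<epsilon>}"
      using linear[of 1 p 1 "\<Sum>j\<in>I. c j *\<^sub>R r j"] G_sum[OF insert.hyps(1), of c r]
    proof eventually_elim
      case (elim w)
      then have Gk: "G (r k) w = G p w + (\<Sum>j\<in>I. c j * G (r j) w)" by (simp add: p_def)
      have vk: "v \<bullet> r k = v \<bullet> p + (\<Sum>j\<in>I. c j * (v \<bullet> r j))"
        by (simp add: p_def inner_diff_right inner_sum_right)
      show ?case
      proof (intro impI)
        assume w: "w \<in> {w \<in> space M. G p w \<in> ?A \<and> (\<lambda>i\<in>I. G (r i) w) \<in> ?B}"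
        then have near: "\<And>i. i \<in> I \<Longrightarrow> \<bar>G (r i) w - v \<bullet> r i\<bar> < \<delta>" and wM: "w \<in> space M"
          unfolding mem_Collect_eq B_iff[unfolded mem_Collect_eq] by auto
        have "G (r k) w - v \<bullet> r k = (G p w - v \<bullet> p) + (\<Sum>j\<in>I. c j * (G (r j) w - v \<bullet> r j))"
          unfolding Gk vk by (simp add: right_diff_distrib sum_subtractf)
        moreover have "\<bar>G p w - v \<bullet> p\<bar> < \<epsilon> / 2" using w by simp
        moreover have "\<bar>\<Sum>j\<in>I. c j * (G (r j) w - v \<bullet> r j)\<bar> \<le> (\<Sum>j\<in>I. \<bar>c j\<bar> * \<delta>)"
          by (rule order_trans[OF sum_abs], rule sum_mono)
             (use less_imp_le[OF near] in \<open>auto simp: abs_mult intro!: mult_left_mono\<close>)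
        moreover have "(\<Sum>j\<in>I. \<bar>c j\<bar> * \<delta>) = \<delta> * S" by (simp add: S_def sum_distrib_left mult.commute)
        ultimately have "\<bar>G (r k) w - v \<bullet> r k\<bar> < \<epsilon>" using \<delta>S by linarith
        then show "w \<in> {w \<in> space M. \<forall>i\<in>insert k I. \<bar>G (r i) w - v \<bullet> r i\<bar> < \<epsilon>}"
          using near \<delta>(2) wM by (auto intro: less_le_trans)
      qed
    qed
    show "{w \<in> space M. \<forall>i\<in>insert k I. \<bar>G (r i) w - v \<bullet> r i\<bar> < \<epsilon>} \<in> events"
      using insert.hyps(1) by (intro sets.sets_Collect_finite_All) simp_all
  qed
  finally show ?case .
qed

text \<open>Almost surely \<open>G v\<close> is a function of the observations plus the independent variable \<open>G p\<close>.
  Conditioning fixes the former and leaves the distribution of the latter unchanged.\<close>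

lemma cond_distribution_orthogonal:
  fixes c :: "'i \<Rightarrow> real" and r :: "'i \<Rightarrow> 'u"
  assumes I: "finite I" and orth: "\<And>i. i \<in> I \<Longrightarrow> p \<bullet> r i = 0"
    and v: "v = (\<Sum>i\<in>I. c i *\<^sub>R r i) + p"
  defines "\<kappa> \<equiv> \<lambda>y. distr M borel (\<lambda>w. (\<Sum>i\<in>I. c i * y i) + G p w)"
  shows "cond_distribution M (G v) (\<Pi>\<^sub>M i\<in>I. borel) (\<lambda>w. \<lambda>i\<in>I. G (r i) w) \<kappa>"
  unfolding cond_distribution_def
proof (intro conjI ballI)
  let ?N = "\<Pi>\<^sub>M i\<in>I. (borel :: real measure)"
  let ?Y = "\<lambda>w. \<lambda>i\<in>I. G (r i) w"
  have "(\<lambda>_. M) \<in> ?N \<rightarrow>\<^sub>M prob_algebra M"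
    by (rule measurable_const) (simp add: space_prob_algebra prob_space_axioms)
  then show \<kappa>_meas[measurable]: "\<kappa> \<in> ?N \<rightarrow>\<^sub>M prob_algebra borel"
    unfolding \<kappa>_def by (rule measurable_distr_prob_space2) measurable
  fix A :: "real set" and B :: "('i \<Rightarrow> real) set"
  assume [measurable]: "A \<in> sets borel" "B \<in> sets ?N"
  interpret Z: prob_space "distr M borel (G p)" by (rule prob_space_distr) simp
  interpret Y: prob_space "distr M ?N ?Y" by (rule prob_space_distr) simp
  interpret ZY: pair_sigma_finite "distr M borel (G p)" "distr M ?N ?Y" ..
  define S where "S = {x \<in> space (borel \<Otimes>\<^sub>M ?N). (\<Sum>i\<in>I. c i * snd x i) + fst x \<in> A \<and> snd x \<in> B}"
  have S[measurable]: "S \<in> sets (borel \<Otimes>\<^sub>M ?N)" unfolding S_def by measurable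
  have \<kappa>A: "emeasure (\<kappa> y) A = emeasure (distr M borel (G p)) ((\<lambda>z. (\<Sum>i\<in>I. c i * y i) + z) -` A)" for y
  proof -
    let ?f = "\<lambda>z. (\<Sum>i\<in>I. c i * y i) + z"
    have "?f \<in> borel_measurable borel" by simp
    then have "?f -` A \<in> sets borel" using \<open>A \<in> sets borel\<close> by (rule measurable_sets_borel)
    then have "emeasure (distr M borel (G p)) (?f -` A) = emeasure M (G p -` (?f -` A) \<inter> space M)"
      by (intro emeasure_distr) simp_all
    also have "\<dots> = emeasure (\<kappa> y) A"
      unfolding \<kappa>_def by (subst emeasure_distr) (simp_all add: vimage_def)
    finally show ?thesis ..
  qed
  have Bsub: "B \<subseteq> space ?N" using sets.sets_into_space[OF \<open>B \<in> sets ?N\<close>] .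
  \<comment> \<open>The sections of the event \<open>S\<close>, over which Fubini integrates.\<close>
  have slice: "emeasure (distr M borel (G p)) ((\<lambda>z. (z, y)) -` S) = indicator B y * emeasure (\<kappa> y) A"
    if "y \<in> space ?N" for y
  proof (cases "y \<in> B")
    case True
    then have "(\<lambda>z. (z, y)) -` S = (\<lambda>z. (\<Sum>i\<in>I. c i * y i) + z) -` A"
      using Bsub by (auto simp: S_def space_pair_measure)
    then show ?thesis using True \<kappa>A[of y] by simp
  next
    case False
    then have "(\<lambda>z. (z, y)) -` S = {}" by (auto simp: S_def)
    then show ?thesis using False by simp
  qed
  have AEv: "AE w in M. G v w = (\<Sum>i\<in>I. c i * G (r i) w) + G p w"
    using linear[of 1 "\<Sum>i\<in>I. c i *\<^sub>R r i" 1 p] G_sum[OF I, of c r]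
    by eventually_elim (simp add: v)
  have \<kappa>prob: "prob_space (\<kappa> y)" for y unfolding \<kappa>_def by (rule prob_space_distr) simp
  have "emeasure M {w \<in> space M. G v w \<in> A \<and> ?Y w \<in> B} =
      emeasure M ((\<lambda>w. (G p w, ?Y w)) -` S \<inter> space M)"
  proof (rule emeasure_eq_AE)
    show "AE w in M. w \<in> {w \<in> space M. G v w \<in> A \<and> ?Y w \<in> B} \<longleftrightarrow>
        w \<in> (\<lambda>w. (G p w, ?Y w)) -` S \<inter> space M"
      using AEv
    proof eventually_elim
      case (elim w)
      have "(\<Sum>i\<in>I. c i * ?Y w i) = (\<Sum>i\<in>I. c i * G (r i) w)" by simp
      then show ?case using elim Bsub by (auto simp: S_def space_pair_measure)
    qed
  qed measurable
  also have "\<dots> = emeasure (distr M (borel \<Otimes>\<^sub>M ?N) (\<lambda>w. (G p w, ?Y w))) S"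
    by (rule emeasure_distr[symmetric]) measurable
  also have "\<dots> = emeasure (distr M borel (G p) \<Otimes>\<^sub>M distr M ?N ?Y) S"
    by (rule arg_cong[where f="\<lambda>D. emeasure D S"], rule joint_distr_orthogonal[symmetric])
       (fact I, rule orth)
  also have "\<dots> = (\<integral>\<^sup>+y. emeasure (distr M borel (G p)) ((\<lambda>z. (z, y)) -` S) \<partial>distr M ?N ?Y)"
    by (rule ZY.emeasure_pair_measure_alt2) measurable
  also have "\<dots> = (\<integral>\<^sup>+y. ennreal (indicator B y * measure (\<kappa> y) A) \<partial>distr M ?N ?Y)"
    by (intro nn_integral_cong)
       (auto simp: slice indicator_def finite_measure.emeasure_eq_measure[OF prob_space.finite_measure[OF \<kappa>prob]])
  also have "\<dots> = ennreal (LINT y|distr M ?N ?Y. indicator B y * measure (\<kappa> y) A)"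
    by (rule nn_integral_eq_integral, rule Y.integrable_const_bound[where B=1])
       (auto simp: indicator_def prob_space.prob_le_1[OF \<kappa>prob])
  finally show "prob {w \<in> space M. G v w \<in> A \<and> ?Y w \<in> B} = (LINT y:B|distr M ?N ?Y. measure (\<kappa> y) A)"
    unfolding emeasure_eq_measure set_lebesgue_integral_def
    by (simp add: integral_nonneg_AE)
qed

text \<open>Translation by \<open>a\<close> multiplies the characteristic function at \<open>t\<close> by \<open>iexp (t * a)\<close>, which is continuous in
  \<open>a\<close>; weak convergence follows from the continuity theorem of Levy.\<close>

lemma weakly_continuous_translates:
  fixes c :: "'i \<Rightarrow> real"
  shows "weakly_continuous I (\<lambda>y. distr M borel (\<lambda>w. (\<Sum>i\<in>I. c i * y i) + G p w))"
  unfolding weakly_continuous_def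
proof (intro allI impI)
  fix z :: "nat \<Rightarrow> 'i \<Rightarrow> real" and y :: "'i \<Rightarrow> real"
  assume *: "(\<forall>n. z n \<in> extensional I) \<and> y \<in> extensional I \<and> (\<forall>i\<in>I. (\<lambda>n. z n i) \<longlonglongrightarrow> y i)"
  have ch: "char (distr M borel (\<lambda>w. a + G p w)) t = iexp (t * a) * char (distr M borel (G p)) t" for a t
    by (simp add: char_def integral_distr exp_add distrib_left)
  show "weak_conv_m (\<lambda>n. distr M borel (\<lambda>w. (\<Sum>i\<in>I. c i * z n i) + G p w))
      (distr M borel (\<lambda>w. (\<Sum>i\<in>I. c i * y i) + G p w))"
  proof (rule levy_continuity)
    show "(\<lambda>n. char (distr M borel (\<lambda>w. (\<Sum>i\<in>I. c i * z n i) + G p w)) t) \<longlonglongrightarrow>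
        char (distr M borel (\<lambda>w. (\<Sum>i\<in>I. c i * y i) + G p w)) t" for t
      unfolding ch by (intro tendsto_intros) (use * in auto)
  qed (rule real_distribution_distr, simp)+
qed

end

section \<open>Conditional means as orthogonal projections\<close>

text \<open>For the functional \<open>v \<bullet> _\<close> the kernel \<open>\<kappa>\<close> has mean \<open>\<Sum>i\<in>I. c i * y i\<close> at \<open>y\<close>. Since \<open>P\<close> takes the
  values \<open>y i\<close> and \<open>p = v - (\<Sum>i\<in>I. c i *\<^sub>R r i)\<close> is orthogonal to \<open>P\<close>, this is \<open>v \<bullet> P\<close>. The
  converse holds since the mean does not depend on the choice of the kernel.\<close>

lemma is_cond_mean_iff_projection:
  fixes \<xi> :: "('u::{real_inner,banach} \<Rightarrow>\<^sub>L real) \<Rightarrow> 'w \<Rightarrow> real"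
  assumes iso: "isonormal M (\<lambda>u. \<xi> (blinfun_inner_right u))" and I: "finite I"
    and \<Phi>: "\<And>i. i \<in> I \<Longrightarrow> \<Phi> i = blinfun_inner_right (r i)"
    and y: "\<And>i. i \<in> I \<Longrightarrow> y i = r i \<bullet> u"
    and P: "P = (\<Sum>i\<in>I. a i *\<^sub>R r i)" "\<And>i. i \<in> I \<Longrightarrow> (u - P) \<bullet> r i = 0"
  shows "is_cond_mean M \<xi> I \<Phi> y L \<longleftrightarrow> L = P"
proof -
  define G where "G v = \<xi> (blinfun_inner_right v)" for v
  interpret isonormal M G using iso unfolding G_def .
  let ?N = "\<Pi>\<^sub>M i\<in>I. (borel :: real measure)"
  let ?Y = "\<lambda>w. \<lambda>i\<in>I. G (r i) w"
  have Y: "(\<lambda>w. \<lambda>i\<in>I. \<xi> (\<Phi> i) w) = ?Y"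
    using \<Phi> by (intro ext) (auto simp: G_def restrict_def)
  have kernel: "\<exists>\<kappa>. cond_distribution M (G v) ?N ?Y \<kappa> \<and> weakly_continuous I \<kappa> \<and>
      integrable (\<kappa> (restrict y I)) (\<lambda>t. t) \<and> (LINT t|\<kappa> (restrict y I). t) = v \<bullet> P" for v
  proof -
    obtain c where c: "\<And>i. i \<in> I \<Longrightarrow> (v - (\<Sum>j\<in>I. c j *\<^sub>R r j)) \<bullet> r i = 0"
      using orthogonal_residual_exists[OF I, of v r] by blast
    define p where "p = v - (\<Sum>j\<in>I. c j *\<^sub>R r j)"
    define \<kappa> where "\<kappa> = (\<lambda>y. distr M borel (\<lambda>w. (\<Sum>i\<in>I. c i * y i) + G p w))"
    have "cond_distribution M (G v) ?N ?Y \<kappa>"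
      unfolding \<kappa>_def by (rule cond_distribution_orthogonal[OF I]) (use c in \<open>simp_all add: p_def\<close>)
    moreover have "weakly_continuous I \<kappa>" unfolding \<kappa>_def by (rule weakly_continuous_translates)
    moreover have "integrable (\<kappa> (restrict y I)) (\<lambda>t. t)"
      unfolding \<kappa>_def by (subst integrable_distr_eq) (simp_all add: integrable_G)
    moreover have "(LINT t|\<kappa> (restrict y I). t) = v \<bullet> P"
    proof -
      have "(LINT t|\<kappa> (restrict y I). t) = (LINT w|M. (\<Sum>i\<in>I. c i * restrict y I i) + G p w)"
        unfolding \<kappa>_def by (rule integral_distr) simp_all
      also have "\<dots> = (\<Sum>i\<in>I. c i * restrict y I i)"
        by (subst Bochner_Integration.integral_add) (simp_all add: integrable_G expectation_G prob_space)
      also have "\<dots> = (\<Sum>i\<in>I. c i * (r i \<bullet> P))"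
        using P(2) y by (intro sum.cong refl) (simp add: inner_diff inner_commute)
      also have "\<dots> = (\<Sum>j\<in>I. c j *\<^sub>R r j) \<bullet> P" by (simp add: inner_sum_left)
      also have "p \<bullet> P = 0" unfolding P(1) inner_sum_right using c by (simp add: p_def)
      then have "(\<Sum>j\<in>I. c j *\<^sub>R r j) \<bullet> P = v \<bullet> P" by (simp add: p_def inner_diff_left)
      finally show ?thesis .
    qed
    ultimately show ?thesis by blast
  qed
  show ?thesis
  proof
    assume "L = P"
    show "is_cond_mean M \<xi> I \<Phi> y L"
      unfolding is_cond_mean_def Y \<open>L = P\<close>
    proof
      fix \<psi> :: "'u \<Rightarrow>\<^sub>L real"
      obtain v where v: "\<psi> = blinfun_inner_right v" using Riesz_representation by blast
      then show "\<exists>\<kappa>. cond_distribution M (\<xi> \<psi>) ?N ?Y \<kappa> \<and> weakly_continuous I \<kappa> \<and>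
          integrable (\<kappa> (restrict y I)) (\<lambda>t. t) \<and> (LINT t|\<kappa> (restrict y I). t) = \<psi> P"
        using kernel[of v] by (simp add: G_def)
    qed
  next
    assume mean: "is_cond_mean M \<xi> I \<Phi> y L"
    have "v \<bullet> L = v \<bullet> P" for v
    proof -
      obtain \<kappa> where \<kappa>: "cond_distribution M (G v) ?N ?Y \<kappa>" "weakly_continuous I \<kappa>"
          "(LINT t|\<kappa> (restrict y I). t) = v \<bullet> P" using kernel[of v] by blast
      obtain \<kappa>' where \<kappa>': "cond_distribution M (G v) ?N ?Y \<kappa>'" "weakly_continuous I \<kappa>'"
          "(LINT t|\<kappa>' (restrict y I). t) = v \<bullet> L"
        using mean[unfolded is_cond_mean_def Y, rule_format, of "blinfun_inner_right v"]
        unfolding G_def[symmetric] by auto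
      have "\<kappa> (restrict y I) = \<kappa>' (restrict y I)"
      proof (rule cond_distribution_unique_at_support[OF _ \<kappa>(1,2) \<kappa>'(1,2)])
        fix \<epsilon> :: real assume "\<epsilon> > 0"
        have "{w \<in> space M. \<forall>i\<in>I. \<bar>?Y w i - restrict y I i\<bar> < \<epsilon>} =
            {w \<in> space M. \<forall>i\<in>I. \<bar>G (r i) w - u \<bullet> r i\<bar> < \<epsilon>}"
          using y by (auto simp: inner_commute)
        then show "prob {w \<in> space M. \<forall>i\<in>I. \<bar>?Y w i - restrict y I i\<bar> < \<epsilon>} > 0"
          using prob_jointly_near_pos[OF I \<open>\<epsilon> > 0\<close>, of r u] by simp
      qed simp_all
      then show ?thesis using \<kappa>(3) \<kappa>'(3) by simp
    qed
    then have "(L - P) \<bullet> (L - P) = 0" by (simp add: inner_diff_right)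
    then show "L = P" by simp
  qed
qed


section \<open>Reproducing kernel Hilbert spaces embedded in \<open>C\<^sup>1\<close>\<close>

lemma rkhs_linear:
  assumes "rkhs \<Omega> K fn" "x \<in> \<Omega>"
  shows "fn (a *\<^sub>R u + b *\<^sub>R v) x = a * fn u x + b * fn v x"
  using assms by (auto simp: rkhs_def inner_add_left dest!: bspec[of _ _ x])

lemma elem_eqI:
  assumes "rkhs \<Omega> K fn" "\<And>x. x \<in> \<Omega> \<Longrightarrow> fn u x = f x"
  shows "elem \<Omega> fn f = u"
  unfolding elem_def
proof (rule the_equality)
  show "v = u" if "\<forall>x\<in>\<Omega>. fn v x = f x" for v
    using assms that unfolding rkhs_def by metis
qed (use assms in blast)

text \<open>The covariance operator is the inverse of the Riesz isomorphism: evaluating the functional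
  \<open>r \<bullet> _\<close> at the kernel function of \<open>x\<close> gives \<open>fn r x\<close> by the reproducing property.\<close>

lemma cov_op_blinfun_inner_right:
  assumes "rkhs \<Omega> K fn"
  shows "cov_op \<Omega> K fn (blinfun_inner_right r) = r"
  unfolding cov_op_def
proof (rule elem_eqI[OF assms])
  fix x assume "x \<in> \<Omega>"
  then obtain k where k: "\<forall>y\<in>\<Omega>. fn k y = K x y" "\<forall>u. fn u x = inner u k"
    using assms unfolding rkhs_def by blast
  have "elem \<Omega> fn (K x) = k" using k(1) by (intro elem_eqI[OF assms]) simp
  then show "fn r x = blinfun_inner_right r (elem \<Omega> fn (K x))" using k(2) by simp
qed

lemma isonormal_if_gaussian_field:
  fixes fn :: "'u::{real_inner,banach} \<Rightarrow> 'x \<Rightarrow> real"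
  assumes "rkhs \<Omega> K fn" "gaussian_field M (cov_op \<Omega> K fn) \<xi>"
  shows "isonormal M (\<lambda>u. \<xi> (blinfun_inner_right u))"
proof -
  have lin: "blinfun_inner_right (a *\<^sub>R u + b *\<^sub>R v) =
      a *\<^sub>R blinfun_inner_right u + b *\<^sub>R blinfun_inner_right v" for a b and u v :: 'u
    by (rule blinfun_eqI) (simp add: inner_add_left blinfun.add_left blinfun.scaleR_left)
  show ?thesis
    using assms(2) unfolding gaussian_field_def isonormal_def isonormal_axioms_def lin
    by (simp add: cov_op_blinfun_inner_right[OF assms(1)] power2_norm_eq_inner)
qed

text \<open>Functions that represent the same element of \<open>U\<close> agree on \<open>\<Omega>\<close> but may differ elsewhere. Derivatives
  at points of \<open>\<Omega>\<close>, and all that is built from them, do not see the difference since \<open>\<Omega>\<close> is open.\<close>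

lemma pd_cong_open:
  assumes "open \<Omega>" "x \<in> \<Omega>" "\<And>y. y \<in> \<Omega> \<Longrightarrow> f y = g y"
  shows "pd b f x = pd b g x"
  unfolding pd_def
proof (rule deriv_cong_ev)
  have "((\<lambda>t. x + t *\<^sub>R b) \<longlongrightarrow> x + 0 *\<^sub>R b) (nhds 0)"
    by (intro tendsto_intros filterlim_ident)
  then have "eventually (\<lambda>t. x + t *\<^sub>R b \<in> \<Omega>) (nhds 0)"
    using assms(1,2) by (intro topological_tendstoD[where l="x + 0 *\<^sub>R b"]) auto
  then show "eventually (\<lambda>t. f (x + t *\<^sub>R b) = g (x + t *\<^sub>R b)) (nhds 0)"
    by eventually_elim (rule assms(3))
qed simp

lemma pds_cong_open:
  assumes "open \<Omega>" "x \<in> \<Omega>" "\<And>y. y \<in> \<Omega> \<Longrightarrow> f y = g y"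
  shows "pds bs f x = pds bs g x"
  using assms(2)
proof (induction bs arbitrary: x)
  case (Cons b bs)
  then show ?case by (auto intro: pd_cong_open[OF assms(1)])
qed (simp add: assms(3))

lemma C_norm_cong_open:
  assumes "open \<Omega>" "\<And>y. y \<in> \<Omega> \<Longrightarrow> f y = g y"
  shows "C_norm m \<Omega> f = C_norm m \<Omega> g"
  unfolding C_norm_def using pds_cong_open[OF assms(1) _ assms(2)] by simp

lemma DEL_cong_open:
  assumes "open \<Omega>" "(y0, y1) \<in> \<Omega>" "(y1, y2) \<in> \<Omega>" "\<And>y. y \<in> \<Omega> \<Longrightarrow> f y = g y"
  shows "DEL f y0 y1 y2 = DEL g y0 y1 y2"
  using assms by (simp add: DEL_def grad1_def grad2_def pd_cong_open[where f=f and g=g])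

lemma normalisation_cong_open:
  assumes "open \<Omega>" "x \<in> \<Omega>" "\<And>y. y \<in> \<Omega> \<Longrightarrow> f y = g y"
  shows "normalisation x f = normalisation x g"
  using assms by (simp add: normalisation_def grad1_def pd_cong_open[where f=f and g=g])

lemma finite_multi: "finite (multi m)"
  unfolding multi_def by (rule finite_lists_length_le) simp

text \<open>The supremum in the definition of the norm is a default value unless the derivatives are bounded.
  They are, because they extend continuously to the compact closure of \<open>\<Omega>\<close>.\<close>

lemma abs_pds_le_C_norm:
  assumes "f \<in> C_closure m \<Omega>" "bounded \<Omega>" "bs \<in> multi m" "x \<in> \<Omega>"
  shows "\<bar>pds bs f x\<bar> \<le> C_norm m \<Omega> f"
proof -
  obtain g where g: "continuous_on (closure \<Omega>) g" "\<And>x. x \<in> \<Omega> \<Longrightarrow> g x = pds bs f x"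
    using assms(1,3) by (auto simp: C_closure_def)
  have "bounded (g ` closure \<Omega>)"
    using assms(2) g(1) by (intro compact_imp_bounded compact_continuous_image) auto
  then obtain B where B: "\<And>x. x \<in> closure \<Omega> \<Longrightarrow> \<bar>g x\<bar> \<le> B" by (auto simp: bounded_iff)
  then have "\<bar>pds bs f x\<bar> \<le> B" if "x \<in> \<Omega>" for x
    using that closure_subset[of \<Omega>] g(2)[OF that] by (metis subsetD)
  then have "bdd_above ((\<lambda>x. \<bar>pds bs f x\<bar>) ` \<Omega>)" by (auto intro!: bdd_aboveI[of _ B])
  then have "\<bar>pds bs f x\<bar> \<le> (SUP x\<in>\<Omega>. \<bar>pds bs f x\<bar>)" using assms(4) by (rule cSUP_upper2[OF _ _ order_refl])
  also have "\<dots> \<le> C_norm m \<Omega> f"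
    unfolding C_norm_def using assms(3) finite_multi by (intro Max_ge) auto
  finally show ?thesis .
qed

text \<open>Linearity holds because \<open>u \<mapsto> fn u x\<close> is linear for \<open>x \<in> \<Omega>\<close> and the derivatives exist;
  boundedness is the continuity of the embedding into \<open>C\<^sup>1\<close>.\<close>

lemma bounded_linear_pd:
  assumes "open \<Omega>" "bounded \<Omega>" "rkhs \<Omega> K fn" "embeds_C 1 \<Omega> fn" "b \<in> Basis" "x \<in> \<Omega>"
  shows "bounded_linear (\<lambda>u. pd b (fn u) x)"
proof -
  have C1: "fn u \<in> C_closure 1 \<Omega>" for u using assms(4) by (simp add: embeds_C_def)
  obtain c where c: "\<And>u. C_norm 1 \<Omega> (fn u) \<le> c * norm u" using assms(4) by (auto simp: embeds_C_def)
  have "(\<lambda>t. fn u (x + t *\<^sub>R b)) differentiable (at 0)" for u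
    using C1[of u] assms(5,6) unfolding C_closure_def C_on_def multi_def by force
  then have D: "((\<lambda>t. fn u (x + t *\<^sub>R b)) has_field_derivative pd b (fn u) x) (at 0)" for u
    by (simp add: pd_def DERIV_deriv_iff_real_differentiable)
  have lin: "pd b (fn (\<alpha> *\<^sub>R u + \<beta> *\<^sub>R v)) x = \<alpha> * pd b (fn u) x + \<beta> * pd b (fn v) x" for \<alpha> \<beta> u v
  proof -
    have "pd b (fn (\<alpha> *\<^sub>R u + \<beta> *\<^sub>R v)) x = pd b (\<lambda>y. \<alpha> * fn u y + \<beta> * fn v y) x"
      using assms(1,6) rkhs_linear[OF assms(3)] by (rule pd_cong_open)
    also have "\<dots> = \<alpha> * pd b (fn u) x + \<beta> * pd b (fn v) x"
      unfolding pd_def[of _ "\<lambda>y. \<alpha> * fn u y + \<beta> * fn v y"]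
      by (intro DERIV_imp_deriv DERIV_add DERIV_cmult D)
    finally show ?thesis .
  qed
  show ?thesis
  proof (rule bounded_linear_intro)
    show "pd b (fn (u + v)) x = pd b (fn u) x + pd b (fn v) x" for u v
      using lin[of 1 u 1 v] by simp
    show "pd b (fn (\<alpha> *\<^sub>R u)) x = \<alpha> *\<^sub>R pd b (fn u) x" for \<alpha> u
      using lin[of \<alpha> u 0 u] by simp
    show "norm (pd b (fn u) x) \<le> norm u * c" for u
      using abs_pds_le_C_norm[OF C1 assms(2) _ assms(6), of "[b]" u] c[of u] assms(5)
      by (simp add: multi_def mult.commute)
  qed
qed

lemma bounded_linear_eval:
  assumes "rkhs \<Omega> K fn" "x \<in> \<Omega>"
  shows "bounded_linear (\<lambda>u. fn u x)"
proof -
  obtain k where "\<And>u. fn u x = u \<bullet> k" using assms unfolding rkhs_def by blast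
  then show ?thesis by (simp add: bounded_linear_inner_left)
qed

lemma continuous_on_pd:
  assumes "f \<in> C_closure 1 \<Omega>" "b \<in> Basis"
  shows "continuous_on \<Omega> (pd b f)"
proof -
  have "[b] \<in> multi 1" using assms(2) by (simp add: multi_def)
  then have "continuous_on \<Omega> (pds [b] f)"
    using assms(1) unfolding C_closure_def C_on_def by blast
  then show ?thesis by (simp add: pds.simps[abs_def])
qed

lemma bounded_linear_obs_map:
  fixes fn :: "'u::{real_inner,banach} \<Rightarrow> (real^'d) \<times> (real^'d) \<Rightarrow> real"
  assumes "open \<Omega>" "bounded \<Omega>" "rkhs \<Omega> K fn" "embeds_C 1 \<Omega> fn" "xb \<in> \<Omega>"
    and X: "\<And>i. X i = (x0 i, x1 i, x2 i)" "\<And>i. (x0 i, x1 i) \<in> \<Omega>" "\<And>i. (x1 i, x2 i) \<in> \<Omega>"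
  shows "bounded_linear (\<lambda>u. obs_map X xb s (fn u))"
proof -
  note bl = bounded_linear_pd[OF assms(1-4)]
  have basis: "(axis a 1, 0) \<in> (Basis :: ((real^'d) \<times> (real^'d)) set)"
      "(0, axis a 1) \<in> (Basis :: ((real^'d) \<times> (real^'d)) set)" for a
    by (auto simp: Basis_prod_def)
  show ?thesis
  proof (cases s)
    case (Dyn i a)
    then show ?thesis
      using bounded_linear_add[OF bl[OF basis(2) X(2)] bl[OF basis(1) X(3)]]
      by (simp add: X(1) DEL_def grad1_def grad2_def)
  next
    case (Mom a)
    then show ?thesis using bounded_linear_minus[OF bl[OF basis(1) assms(5)]]
      by (simp add: normalisation_def grad1_def)
  next
    case Val
    then show ?thesis using bounded_linear_eval[OF assms(3,5)] by (simp add: normalisation_def)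
  qed
qed

lemma continuous_on_constant_if_dense:
  fixes F :: "'a::metric_space \<Rightarrow> 'b::t2_space"
  assumes "continuous_on S F" "D \<subseteq> S" "S \<subseteq> closure D" "\<And>x. x \<in> D \<Longrightarrow> F x = c" "x \<in> S"
  shows "F x = c"
proof -
  obtain s where s: "\<And>n. s n \<in> D" "s \<longlonglongrightarrow> x" using assms(3,5) closure_sequential[of x D] by blast
  have "(F \<circ> s) \<longlonglongrightarrow> F x"
    using assms(1,2,5) s unfolding continuous_on_sequentially by (metis subsetD)
  moreover have "F \<circ> s = (\<lambda>_. c)" using s(1) assms(4) by auto
  ultimately show ?thesis by (simp add: LIMSEQ_const_iff)
qed

lemma obs_upto_mono: "j \<le> k \<Longrightarrow> obs_upto j \<subseteq> obs_upto k"
  by (auto simp: obs_upto_def)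

lemma finite_obs_upto: "finite (obs_upto j :: 'd::finite obs set)"
proof -
  have "{Dyn i a | i a. i < j} = (\<lambda>(i, a). Dyn i (a :: 'd)) ` ({..<j} \<times> UNIV)" by auto
  then show ?thesis by (simp add: obs_upto_def)
qed

lemma eventually_in_obs_upto: "\<exists>j. s \<in> obs_upto j"
  by (cases s) (auto simp: obs_upto_def)

section \<open>Convergence of the conditional means\<close>

theorem theorem6p9:
  fixes \<Omega>a \<Omega>b \<Omega> :: "((real^'d) \<times> (real^'d)) set"
    and X :: "nat \<Rightarrow> (real^'d) \<times> (real^'d) \<times> (real^'d)"
    and x0 x1 x2 :: "nat \<Rightarrow> real^'d"
    and gref :: "(real^'d) \<times> (real^'d) \<Rightarrow> real^'d"
    and gbar :: "(real^'d) \<times> (real^'d) \<Rightarrow> (real^'d) \<times> (real^'d)"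
    and Lref :: "(real^'d) \<times> (real^'d) \<Rightarrow> real"
    and K :: "(real^'d) \<times> (real^'d) \<Rightarrow> (real^'d) \<times> (real^'d) \<Rightarrow> real"
    and xb :: "(real^'d) \<times> (real^'d)" and cb :: real and pb :: "real^'d"
    and fn :: "'u::{real_inner,banach} \<Rightarrow> (real^'d) \<times> (real^'d) \<Rightarrow> real"
    and M :: "'w measure"
    and \<xi> :: "('u \<Rightarrow>\<^sub>L real) \<Rightarrow> 'w \<Rightarrow> real"
  assumes "open \<Omega>a" "bounded \<Omega>a" "\<Omega>a \<noteq> {}"
    and "open \<Omega>b" "bounded \<Omega>b" "\<Omega>b \<noteq> {}"
    and Omega: "\<Omega> = \<Omega>a \<union> \<Omega>b"
    and X: "\<And>j. X j = (x0 j, x1 j, x2 j)"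
    and obs: "\<And>j. (x0 j, x1 j) \<in> \<Omega>a" "\<And>j. (x1 j, x2 j) \<in> \<Omega>b"
    and gbar: "\<And>p. gbar p = (snd p, gref p)"
    and flow: "gbar ` \<Omega>a \<subseteq> \<Omega>b" "\<exists>C. C-lipschitz_on \<Omega>a gbar"
    and Lref_C1: "Lref \<in> C_closure 1 \<Omega>"
    and data: "\<And>j. gbar (x0 j, x1 j) = (x1 j, x2 j)"
    and DEL_flow: "\<And>y0 y1. (y0, y1) \<in> \<Omega>a \<Longrightarrow> DEL Lref y0 y1 (gref (y0, y1)) = 0"
    and DEL_unique: "\<And>y0 y1 y2. (y0, y1) \<in> \<Omega>a \<Longrightarrow> (y1, y2) \<in> \<Omega>b \<Longrightarrow>
          DEL Lref y0 y1 y2 = 0 \<Longrightarrow> y2 = gref (y0, y1)"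
    and nondegenerate: "\<And>p. p \<in> closure \<Omega>b \<Longrightarrow> \<exists>A. has_mixed_closure \<Omega> \<Omega>b Lref p A \<and> invertible A"
    and dense: "\<Omega>a \<subseteq> closure (range (\<lambda>j. (x0 j, x1 j)))"
    and kernel: "pd_kernel \<Omega> K" "(\<lambda>(x, y). K x y) \<in> C_on 2 (\<Omega> \<times> \<Omega>)"
    and xb: "xb \<in> \<Omega>"
    and U: "rkhs \<Omega> K fn"
    and Lref_U: "in_space \<Omega> fn Lref"
    and Lref_norm: "normalisation xb Lref = (pb, cb)"
    and embed: "embeds_C 1 \<Omega> fn"
    and field: "gaussian_field M (cov_op \<Omega> K fn) \<xi>"
  shows "\<exists>L Linf.
     (\<forall>j u. lagrangian_mean M \<xi> fn X xb pb cb j u \<longleftrightarrow> u = L j) \<and>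
     L \<longlonglongrightarrow> Linf \<and>
     (\<lambda>j. C_norm 1 \<Omega> (\<lambda>p. fn (L j) p - fn Linf p)) \<longlonglongrightarrow> 0 \<and>
     normalisation xb (fn Linf) = (pb, cb) \<and>
     consistent \<Omega>a \<Omega>b Lref (fn Linf) \<and>
     (\<forall>v. is_arg_min norm
        (\<lambda>u. normalisation xb (fn u) = (pb, cb) \<and> consistent \<Omega>a \<Omega>b Lref (fn u)) v \<longleftrightarrow> v = Linf)"
proof -
  have open_\<Omega>: "open \<Omega>" and bounded_\<Omega>: "bounded \<Omega>" and ne_\<Omega>: "\<Omega> \<noteq> {}"
    using assms(1-6) Omega by auto
  have C1: "fn u \<in> C_closure 1 \<Omega>" for u using embed by (simp add: embeds_C_def)
  obtain u0 where u0: "\<And>p. p \<in> \<Omega> \<Longrightarrow> fn u0 p = Lref p" using Lref_U unfolding in_space_def by blast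
  have DEL_u0: "DEL (fn u0) y0 y1 y2 = DEL Lref y0 y1 y2" if "(y0, y1) \<in> \<Omega>a" "(y1, y2) \<in> \<Omega>b" for y0 y1 y2
    using that Omega u0 by (intro DEL_cong_open[OF open_\<Omega>]) auto
  have normalisation_u0: "normalisation xb (fn u0) = (pb, cb)"
    using normalisation_cong_open[OF open_\<Omega> xb u0] Lref_norm by simp
  have x2: "gref (x0 j, x1 j) = x2 j" for j using data[of j] by (simp add: gbar)
  have DEL_data: "DEL Lref (x0 j) (x1 j) (x2 j) = 0" for j
    using DEL_flow[OF obs(1)[of j]] by (simp add: x2)

  define \<Phi> where "\<Phi> s = Blinfun (\<lambda>u. obs_map X xb s (fn u))" for s
  have "bounded_linear (\<lambda>u. obs_map X xb s (fn u))" for s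
    using obs Omega by (intro bounded_linear_obs_map[OF open_\<Omega> bounded_\<Omega> U embed xb X]) auto
  then have \<Phi>_apply: "blinfun_apply (\<Phi> s) u = obs_map X xb s (fn u)" for s u
    unfolding \<Phi>_def by (simp add: bounded_linear_Blinfun_apply)
  have "\<forall>s. \<exists>v. \<Phi> s = blinfun_inner_right v" by (intro allI Riesz_representation)
  then obtain r where r: "\<And>s. \<Phi> s = blinfun_inner_right (r s)" by (auto dest!: choice)
  have r_inner: "r s \<bullet> u = obs_map X xb s (fn u)" for s u
    using \<Phi>_apply[of s u] by (simp add: r)
  have y_u0: "obs_val pb cb s = r s \<bullet> u0" for s
    using normalisation_u0 DEL_data DEL_u0[OF obs]
    by (cases s) (simp_all add: r_inner X)

  \<comment> \<open>The normalised and consistent elements form the affine subspace cut out by all observations.\<close>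
  have feasible_iff: "normalisation xb (fn u) = (pb, cb) \<and> consistent \<Omega>a \<Omega>b Lref (fn u) \<longleftrightarrow>
      (\<forall>s. r s \<bullet> u = obs_val pb cb s)" for u
  proof (intro iffI allI)
    fix s assume *: "normalisation xb (fn u) = (pb, cb) \<and> consistent \<Omega>a \<Omega>b Lref (fn u)"
    then have "DEL (fn u) (x0 i) (x1 i) (x2 i) = 0" for i
      using obs DEL_data unfolding consistent_def by blast
    with * show "r s \<bullet> u = obs_val pb cb s" by (cases s) (simp_all add: r_inner X)
  next
    assume *: "\<forall>s. r s \<bullet> u = obs_val pb cb s"
    have "normalisation xb (fn u) = (pb, cb)"
      using *[rule_format, of Val] *[rule_format, of "Mom _"]
      by (simp add: r_inner prod_eq_iff vec_eq_iff)
    moreover have "consistent \<Omega>a \<Omega>b Lref (fn u)"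
      unfolding consistent_def
    proof (intro allI impI)
      fix y0 y1 y2 assume y: "(y0, y1) \<in> \<Omega>a \<and> (y1, y2) \<in> \<Omega>b \<and> DEL Lref y0 y1 y2 = 0"
      then have y2: "gref (y0, y1) = y2" using DEL_unique by blast
      obtain C where "C-lipschitz_on \<Omega>a gbar" using flow(2) by blast
      then have gbar_cont: "continuous_on \<Omega>a gbar" by (rule lipschitz_on_continuous_on)
      have "DEL (fn u) y0 y1 y2 $ a = 0" for a
      proof -
        \<comment> \<open>The component \<open>a\<close> of the Euler-Lagrange operator along the flow.\<close>
        let ?F = "\<lambda>p. pd (0, axis a 1) (fn u) p + pd (axis a 1, 0) (fn u) (gbar p)"
        have basis: "(axis a 1, 0) \<in> (Basis :: ((real^'d) \<times> (real^'d)) set)"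
            "(0, axis a 1) \<in> (Basis :: ((real^'d) \<times> (real^'d)) set)"
          by (auto simp: Basis_prod_def)
        have cont: "continuous_on \<Omega>a ?F"
          using flow(1) Omega
          by (intro continuous_on_add continuous_on_compose2[OF continuous_on_pd[OF C1 basis(1)] gbar_cont]
              continuous_on_subset[OF continuous_on_pd[OF C1 basis(2)]]) auto
        have "?F (y0, y1) = 0"
        proof (rule continuous_on_constant_if_dense[OF cont _ dense])
          fix p assume "p \<in> range (\<lambda>j. (x0 j, x1 j))"
          then obtain j where p: "p = (x0 j, x1 j)" by blast
          then show "?F p = 0"
            using *[rule_format, of "Dyn j a"] data[of j]
            by (simp add: r_inner X DEL_def grad1_def grad2_def)
        qed (use obs y in auto)
        then show ?thesis by (simp add: DEL_def grad1_def grad2_def gbar y2)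
      qed
      then show "DEL (fn u) y0 y1 y2 = 0" by (simp add: vec_eq_iff)
    qed
    ultimately show "normalisation xb (fn u) = (pb, cb) \<and> consistent \<Omega>a \<Omega>b Lref (fn u)" ..
  qed

  have "\<forall>j. \<exists>c. \<forall>s\<in>obs_upto j. (u0 - (\<Sum>t\<in>obs_upto j. c t *\<^sub>R r t)) \<bullet> r s = 0"
    by (intro allI orthogonal_residual_exists finite_obs_upto)
  from choice[OF this] obtain c
    where c: "\<And>j s. s \<in> obs_upto j \<Longrightarrow> (u0 - (\<Sum>t\<in>obs_upto j. c j t *\<^sub>R r t)) \<bullet> r s = 0"
    by auto
  define P where "P j = (\<Sum>t\<in>obs_upto j. c j t *\<^sub>R r t)" for j
  have P_obs: "r s \<bullet> P j = obs_val pb cb s" if "s \<in> obs_upto j" for j s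
    using c[OF that] by (simp add: P_def[symmetric] y_u0 inner_diff inner_commute)
  \<comment> \<open>\<open>P j\<close> lies in the span of the first observations, and \<open>u - P j\<close> is orthogonal to it.\<close>
  have P_orth: "P j \<bullet> (u - P j) = 0" if "\<And>s. s \<in> obs_upto j \<Longrightarrow> r s \<bullet> u = obs_val pb cb s" for j u
  proof -
    have "r s \<bullet> (u - P j) = 0" if "s \<in> obs_upto j" for s
      using that P_obs[OF that] \<open>\<And>s. s \<in> obs_upto j \<Longrightarrow> r s \<bullet> u = obs_val pb cb s\<close>[OF that]
      by (simp add: inner_diff_right)
    then show ?thesis by (subst P_def) (simp add: inner_sum_left)
  qed
  have mean_iff: "lagrangian_mean M \<xi> fn X xb pb cb j u \<longleftrightarrow> u = P j" for j u
    unfolding lagrangian_mean_def \<Phi>_def[symmetric]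
    by (rule is_cond_mean_iff_projection[OF isonormal_if_gaussian_field[OF U field] finite_obs_upto r y_u0 P_def])
       (use c in \<open>simp add: P_def\<close>)

  have pythagoras: "(norm u)\<^sup>2 = (norm v)\<^sup>2 + (norm (u - v))\<^sup>2" if "v \<bullet> (u - v) = 0" for u v :: 'u
    using that by (simp add: power2_norm_eq_inner inner_diff inner_commute)
  have P_bounded: "norm (P j) \<le> norm u0" for j
    using pythagoras[OF P_orth[of j u0]] y_u0 by (simp add: power2_le_imp_le)
  have "convergent P"
  proof (rule convergent_of_increasing_projections[OF P_orth P_bounded])
    show "r s \<bullet> P k = obs_val pb cb s" if "j \<le> k" "s \<in> obs_upto j" for j k s
      using that obs_upto_mono by (intro P_obs) blast
  qed
  then obtain Linf where Linf: "P \<longlonglongrightarrow> Linf" by (auto simp: convergent_def)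
  have Linf_obs: "r s \<bullet> Linf = obs_val pb cb s" for s
  proof -
    obtain j where j: "s \<in> obs_upto j" using eventually_in_obs_upto by blast
    have "eventually (\<lambda>k. r s \<bullet> P k = obs_val pb cb s) sequentially"
      using eventually_ge_at_top[of j]
    proof eventually_elim
      case (elim k)
      with j obs_upto_mono show ?case by (intro P_obs) blast
    qed
    then have "(\<lambda>k. r s \<bullet> P k) \<longlonglongrightarrow> obs_val pb cb s" by (rule tendsto_eventually)
    moreover have "(\<lambda>k. r s \<bullet> P k) \<longlonglongrightarrow> r s \<bullet> Linf" by (intro tendsto_intros Linf)
    ultimately show ?thesis by (rule LIMSEQ_unique[rotated])
  qed
  have Linf_orth: "Linf \<bullet> (u - Linf) = 0" if "\<And>s. r s \<bullet> u = obs_val pb cb s" for u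
  proof -
    have "(\<lambda>j. P j \<bullet> (u - P j)) \<longlonglongrightarrow> Linf \<bullet> (u - Linf)" by (intro tendsto_intros Linf)
    then show ?thesis using P_orth[OF that] by (simp add: LIMSEQ_const_iff)
  qed

  have "is_arg_min norm (\<lambda>u. normalisation xb (fn u) = (pb, cb) \<and> consistent \<Omega>a \<Omega>b Lref (fn u)) v
      \<longleftrightarrow> v = Linf" for v
  proof -
    have norm_eq: "(norm u)\<^sup>2 = (norm Linf)\<^sup>2 + (norm (u - Linf))\<^sup>2"
      if "\<forall>s. r s \<bullet> u = obs_val pb cb s" for u
      using that by (intro pythagoras Linf_orth) blast
    have le: "norm Linf \<le> norm u" if "\<forall>s. r s \<bullet> u = obs_val pb cb s" for u
      using norm_eq[OF that] by (simp add: power2_le_imp_le)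
    show ?thesis
      unfolding feasible_iff is_arg_min_def
    proof (intro iffI conjI)
      assume v: "(\<forall>s. r s \<bullet> v = obs_val pb cb s) \<and>
          \<not> (\<exists>u. (\<forall>s. r s \<bullet> u = obs_val pb cb s) \<and> norm u < norm v)"
      then have "norm v = norm Linf" using le[of v] Linf_obs by (meson antisym not_less)
      then show "v = Linf" using norm_eq[of v] v by simp
    qed (use Linf_obs le in \<open>auto simp: not_less\<close>)
  qed
  moreover have "(\<lambda>j. C_norm 1 \<Omega> (\<lambda>p. fn (P j) p - fn Linf p)) \<longlonglongrightarrow> 0"
  proof -
    obtain C where C: "\<And>u. C_norm 1 \<Omega> (fn u) \<le> C * norm u" using embed by (auto simp: embeds_C_def)
    have eq: "C_norm 1 \<Omega> (\<lambda>p. fn (P j) p - fn Linf p) = C_norm 1 \<Omega> (fn (P j - Linf))" for j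
      using rkhs_linear[OF U, of _ 1 "P j" "-1" Linf]
      by (intro C_norm_cong_open[OF open_\<Omega>]) simp
    have nonneg: "0 \<le> C_norm 1 \<Omega> (fn u)" for u
    proof -
      obtain p where "p \<in> \<Omega>" using ne_\<Omega> by blast
      then show ?thesis
        using abs_pds_le_C_norm[OF C1 bounded_\<Omega>, of "[]" p u] by (simp add: multi_def)
    qed
    have "(\<lambda>j. C * norm (P j - Linf)) \<longlonglongrightarrow> C * norm (Linf - Linf)" by (intro tendsto_intros Linf)
    then have "(\<lambda>j. C * norm (P j - Linf)) \<longlonglongrightarrow> 0" by simp
    then show ?thesis
      unfolding eq by (rule tendsto_sandwich[OF _ _ tendsto_const, rotated 2]) (intro always_eventually allI nonneg C)+
  qed
  ultimately show ?thesis
    using mean_iff Linf feasible_iff[of Linf] Linf_obs by (intro exI[of _ P] exI[of _ Linf]) simp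
qed

end
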